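(* Let $p\ge 1$, $q\ge 0$, $a_0>0$, $a_1,\dots,a_p\ge 0$, $b_1,\dots,b_q\ge 0$, and let $(\epsilon_t)_{t\in\mathbb{Z}}$ be an i.i.d. sequence of $\mathbb{N}_0$-valued random variables with mean $E[\epsilon_t]=1$ and variance $V[\epsilon_t]=\sigma^2$. Consider the binomial count multiplicative error model $$X_t=M_t\otimes\epsilon_t,\qquad M_t=a_0+\sum_{i=1}^p a_iX_{t-i}+\sum_{j=1}^q b_jM_{t-j},\qquad t\in\mathbb{Z},$$ where $\otimes$ is the binomial multiplicative operator. If $$\sum_{i=1}^p a_i+\sum_{j=1}^q b_j<1,$$ then there exists a weakly dependent, stationary and ergodic solution $(X_t)_{t\in\mathbb{Z}}$ to this model.
   Context: Binomial multiplicative operator: for real $\alpha>0$ and an $\mathbb{N}_0$-valued random variable $\epsilon$, $$\alpha\otimes\epsilon=\lfloor\alpha\rfloor\cdot\epsilon+\mathrm{Bin}\big(\epsilon,\ \alpha-\lfloor\alpha\rfloor\big),$$ where $\lfloor\alpha\rfloor$ is the greatest integer $\le\alpha$ and $\mathrm{Bin}(\epsilon,\alpha-\lfloor\alpha\rfloor)$ denotes a random variable which, conditionally on $\epsilon$, is binomially distributed with $\epsilon$ trials and success probability $\alpha-\lfloor\alpha\rfloor$; the two summands are conditionally independent given $\epsilon$. Model: $\mathcal F_{t-1}$ is the $\sigma$-field generated by $\{(X_{t-1},M_{t-1}),(X_{t-2},M_{t-2}),\dots\}$; $M_t$ is determined by $\mathcal F_{t-1}$; $\epsilon_t$ is generated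 independently of $\mathcal F_{t-1}$; the operator at time $t$ is executed independently of $\mathcal F_{t-1}$ and $\epsilon_t$. So, conditionally on $\mathcal F_{t-1}$ and $\epsilon_t$, $X_t$ is distributed as $\lfloor M_t\rfloor\epsilon_t+\mathrm{Bin}(\epsilon_t,M_t-\lfloor M_t\rfloor)$. The randomness driving the process at time $t$ (the pair consisting of $\epsilon_t$ and the binomial randomization at time $t$) forms an i.i.d. sequence over $t$. Weak dependence is meant in the sense of Doukhan and Wintenberger (2008), i.e. $\tau$-weak dependence: for an integrable $\mathbb{R}^l$-valued random vector $Y$ and a $\sigma$-field $\mathcal M$ put $$\tau(\mathcal M,Y)=E\left[\sup_f\left|E[f(Y)\mid\mathcal M]-E[f(Y)]\right|\right],$$ the supremum (inside the expectation, taken with a regular conditional distribution of $Y$ given $\mathcal M$) being over all $f:\mathbb{R}^l\to\mathbb{R}$ that are $1$-Lipschitz with respect to $\|y\|=\sum_{k=1}^l|y_k|$. A stationary process $(X_t)$ is $\tau$-weakly dependent if $$\tau_\infty(r)=\sup_{l\ge1}\ \frac1l\ \sup_{r\le j_1<\cdots<j_l}\tau\big(\sigma(X_s:s\le0),(X_{j_1},\dots,X_{j_l})\big)\longrightarrow0\quad\text{as } r\to\infty.$$ *)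

theory Defs
  imports "HOL-Probability.Probability"
begin

definition iid :: "'w measure \<Rightarrow> 's measure \<Rightarrow> (int \<Rightarrow> 'w \<Rightarrow> 's) \<Rightarrow> bool" where
  "iid P S Y \<longleftrightarrow> prob_space.indep_vars P (\<lambda>_. S) Y UNIV \<and> (\<forall>s t. distr P S (Y s) = distr P S (Y t))"

definition generated_sigma :: "'w measure \<Rightarrow> 's measure \<Rightarrow> 'i set \<Rightarrow> ('i \<Rightarrow> 'w \<Rightarrow> 's) \<Rightarrow> 'w measure" where
  "generated_sigma P S I Y = sigma (space P) (\<Union>i\<in>I. {Y i -` A \<inter> space P | A. A \<in> sets S})"

definition path_law :: "'w measure \<Rightarrow> 's measure \<Rightarrow> (int \<Rightarrow> 'w \<Rightarrow> 's) \<Rightarrow> (int \<Rightarrow> 's) measure" where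
  "path_law P S Y = distr P (Pi\<^sub>M UNIV (\<lambda>_. S)) (\<lambda>\<omega> t. Y t \<omega>)"

definition stationary :: "'w measure \<Rightarrow> 's measure \<Rightarrow> (int \<Rightarrow> 'w \<Rightarrow> 's) \<Rightarrow> bool" where
  "stationary P S Y \<longleftrightarrow> (\<forall>t. Y t \<in> measurable P S) \<and>
     (\<forall>h. path_law P S (\<lambda>t. Y (t + h)) = path_law P S Y)"

definition ergodic :: "'w measure \<Rightarrow> 's measure \<Rightarrow> (int \<Rightarrow> 'w \<Rightarrow> 's) \<Rightarrow> bool" where
  "ergodic P S Y \<longleftrightarrow>
     (\<forall>A \<in> sets (Pi\<^sub>M UNIV (\<lambda>_. S)).
        (\<lambda>x t. x (t + 1)) -` A \<inter> space (Pi\<^sub>M UNIV (\<lambda>_::int. S)) = A \<longrightarrow>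
        measure (path_law P S Y) A = 0 \<or> measure (path_law P S Y) A = 1)"

text \<open>Vectors in \<open>\<real>\<^sup>l\<close>, with varying \<open>l\<close>, are the extensional functions on \<open>{..<l}\<close>.\<close>

abbreviation vec_space :: "nat \<Rightarrow> (nat \<Rightarrow> real) measure" where
  "vec_space l \<equiv> Pi\<^sub>M {..<l} (\<lambda>_. borel)"

definition regular_cond_distr ::
  "'w measure \<Rightarrow> 'w measure \<Rightarrow> 's measure \<Rightarrow> ('w \<Rightarrow> 's) \<Rightarrow> ('w \<Rightarrow> 's measure) \<Rightarrow> bool" where
  "regular_cond_distr P F S Y \<kappa> \<longleftrightarrow> \<kappa> \<in> measurable F (prob_algebra S) \<and>
     (\<forall>A \<in> sets S. AE \<omega> in P.
        measure (\<kappa> \<omega>) A = real_cond_exp P F (indicator (Y -` A \<inter> space P)) \<omega>)"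

definition Lip1 :: "nat \<Rightarrow> ((nat \<Rightarrow> real) \<Rightarrow> real) set" where
  "Lip1 l = {f. \<forall>x \<in> space (vec_space l). \<forall>y \<in> space (vec_space l).
                  \<bar>f x - f y\<bar> \<le> (\<Sum>k<l. \<bar>x k - y k\<bar>)}"

text \<open>A regular conditional distribution on \<open>\<real>\<^sup>l\<close> is unique up to a null set, so the integral
  below does not depend on \<open>\<kappa>\<close>; the infimum merely selects this common value.\<close>

definition tau :: "'w measure \<Rightarrow> 'w measure \<Rightarrow> nat \<Rightarrow> ('w \<Rightarrow> nat \<Rightarrow> real) \<Rightarrow> ennreal" where
  "tau P F l Y =
     (INF \<kappa> \<in> {\<kappa>. regular_cond_distr P F (vec_space l) Y \<kappa>}.
        \<integral>\<^sup>+\<omega>. (SUP f \<in> Lip1 l. ennreal \<bar>(\<integral>y. f y \<partial>\<kappa> \<omega>) - (\<integral>\<omega>'. f (Y \<omega>') \<partial>P)\<bar>) \<partial>P)"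

definition tau_inf :: "'w measure \<Rightarrow> (int \<Rightarrow> 'w \<Rightarrow> real) \<Rightarrow> nat \<Rightarrow> ennreal" where
  "tau_inf P X r =
     (SUP l \<in> {1..}.
        (SUP j \<in> {j :: nat \<Rightarrow> int. strict_mono_on {..<l} j \<and> (\<forall>k<l. int r \<le> j k)}.
           tau P (generated_sigma P borel {..0} X) l (\<lambda>\<omega>. \<lambda>k\<in>{..<l}. X (j k) \<omega>))
        / of_nat l)"

definition tau_weakly_dependent :: "'w measure \<Rightarrow> (int \<Rightarrow> 'w \<Rightarrow> real) \<Rightarrow> bool" where
  "tau_weakly_dependent P X \<longleftrightarrow> stationary P borel X \<and> (\<forall>t. integrable P (X t)) \<and>
     tau_inf P X \<longlonglongrightarrow> 0"

text \<open>\<open>Bin(n, p)\<close> is executed as \<open>B n p z\<close>, where \<open>z\<close> is the realisation of the randomization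
  variable \<open>Z t\<close> with values in \<open>S\<close>.\<close>

definition binomial_sampler ::
  "'w measure \<Rightarrow> 'z measure \<Rightarrow> ('w \<Rightarrow> 'z) \<Rightarrow> (nat \<Rightarrow> real \<Rightarrow> 'z \<Rightarrow> nat) \<Rightarrow> bool" where
  "binomial_sampler P S Z B \<longleftrightarrow>
     (\<lambda>(n, p, z). B n p z) \<in> measurable (count_space UNIV \<Otimes>\<^sub>M borel \<Otimes>\<^sub>M S) (count_space UNIV) \<and>
     Z \<in> measurable P S \<and>
     (\<forall>n. \<forall>p \<in> {0..1}. distr P (count_space UNIV) (\<lambda>\<omega>. B n p (Z \<omega>)) = measure_pmf (binomial_pmf n p))"

definition binomial_mult :: "(nat \<Rightarrow> real \<Rightarrow> 'z \<Rightarrow> nat) \<Rightarrow> real \<Rightarrow> nat \<Rightarrow> 'z \<Rightarrow> nat" where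
  "binomial_mult B \<alpha> n z = nat \<lfloor>\<alpha>\<rfloor> * n + B n (\<alpha> - of_int \<lfloor>\<alpha>\<rfloor>) z"

definition cmem_past :: "'w measure \<Rightarrow> (int \<Rightarrow> 'w \<Rightarrow> nat) \<Rightarrow> (int \<Rightarrow> 'w \<Rightarrow> real) \<Rightarrow> int \<Rightarrow> 'w measure" where
  "cmem_past P X M t =
     generated_sigma P (count_space UNIV \<Otimes>\<^sub>M borel) {..t} (\<lambda>s \<omega>. (X s \<omega>, M s \<omega>))"

text \<open>The conditional law of \<open>X t\<close> given \<open>cmem_past P X M (t - 1)\<close> and \<open>\<epsilon> t\<close> follows from the
  independence of \<open>Z t\<close> of both. Positivity of \<open>M t\<close> is the domain condition of the operator.\<close>

definition cmem_solution ::
  "'w measure \<Rightarrow> nat \<Rightarrow> nat \<Rightarrow> (nat \<Rightarrow> real) \<Rightarrow> (nat \<Rightarrow> real) \<Rightarrow> (int \<Rightarrow> 'w \<Rightarrow> nat) \<Rightarrow>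
   'z measure \<Rightarrow> (int \<Rightarrow> 'w \<Rightarrow> 'z) \<Rightarrow> (nat \<Rightarrow> real \<Rightarrow> 'z \<Rightarrow> nat) \<Rightarrow>
   (int \<Rightarrow> 'w \<Rightarrow> nat) \<Rightarrow> (int \<Rightarrow> 'w \<Rightarrow> real) \<Rightarrow> bool" where
  "cmem_solution P p q a b \<epsilon> S Z B X M \<longleftrightarrow>
     iid P (count_space UNIV \<Otimes>\<^sub>M S) (\<lambda>t \<omega>. (\<epsilon> t \<omega>, Z t \<omega>)) \<and>
     (\<forall>t. binomial_sampler P S (Z t) B \<and>
       X t \<in> measurable P (count_space UNIV) \<and>
       M t \<in> borel_measurable P \<and>
       prob_space.indep_set P
         (sets (cmem_past P X M (t - 1)))
         (sets (vimage_algebra (space P) (\<epsilon> t) (count_space UNIV))) \<and>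
       prob_space.indep_set P
         (sigma_sets (space P) (sets (cmem_past P X M (t - 1)) \<union>
            sets (vimage_algebra (space P) (\<epsilon> t) (count_space UNIV))))
         (sets (vimage_algebra (space P) (Z t) S)) \<and>
       (AE \<omega> in P. 0 < M t \<omega>) \<and>
       (AE \<omega> in P. X t \<omega> = binomial_mult B (M t \<omega>) (\<epsilon> t \<omega>) (Z t \<omega>)) \<and>
       (AE \<omega> in P. M t \<omega> = a 0 + (\<Sum>i=1..p. a i * real (X (t - int i) \<omega>))
                               + (\<Sum>j=1..q. b j * M (t - int j) \<omega>)))"

end

theory Submission
  imports Defs
begin

text \<open>
  Execute \<open>\<alpha> \<otimes> n\<close> with i.i.d. uniform thresholds \<open>u\<^sub>i\<close> as the sum of the numbers
  \<open>\<lceil>\<alpha> - u\<^sub>i\<rceil>\<close> over \<open>i < n\<close>. This is increasing and left-continuous in \<open>\<alpha>\<close>, so the Picard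
  iterates of the recursion, started at 0, increase pathwise to a solution. Since the operator
  preserves the mean (\<open>E[\<epsilon>] = 1\<close>), the expectations of the iterates satisfy
  \<open>m\<^sub>n\<^sub>+\<^sub>1 = a\<^sub>0 + \<rho> m\<^sub>n\<close>, where \<open>\<rho> < 1\<close> is the sum of the coefficients; hence the limit is
  integrable and the \<open>n\<close>-th iterate has \<open>L\<^sup>1\<close>-distance \<open>a\<^sub>0 \<rho>\<^sup>n / (1 - \<rho>)\<close> from it.
  The solution is a shift-equivariant function of the i.i.d. noise, hence stationary and
  ergodic. The \<open>n\<close>-th iterate uses only finitely many noise variables, so at times after \<open>r\<close>
  it is independent of the past for \<open>n\<close> of order \<open>r\<close>, and \<open>\<tau>\<close> is at most twice
  the \<open>L\<^sup>1\<close>-distance.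
\<close>

section \<open>Bounding the tau coefficient\<close>


text \<open>For fixed noise the operator is a step function of \<open>\<alpha>\<close>, so it
  contracts only in mean and no contraction argument works path by path. Monotonicity replaces it,
  and left-continuity is the half of continuity that an increasing limit needs. Using the same
  thresholds for every \<open>\<alpha>\<close> orders the counts of the iterates, and for ordered
  variables the L1 distance is a difference of expectations. Since \<open>tau\<close> is an infimum
  over regular conditional distributions, bounding it means exhibiting one. The counts are integers,
  so conditional probabilities of single points serve as a density. The factor 2 arises because the
  process is replaced by its iterate twice: under the conditional law given the past and under the
  unconditional law. Ergodicity is reduced to the noise, whose shift is shown to be mixing, from
  cylinders upwards.\<close>

lemma Lip1_measurable:
  assumes "f \<in> Lip1 l"
  shows "f \<in> borel_measurable (vec_space l)"
proof -
  define R where "R = PiE {..<l} (\<lambda>_. \<rat> :: real set)"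
  have R: "countable R"
    unfolding R_def by (intro countable_PiE) (auto simp: countable_rat)
  have Rs: "q \<in> space (vec_space l)" if "q \<in> R" for q
    using that by (auto simp: R_def space_PiM PiE_iff)
  have lip: "\<bar>f x - f y\<bar> \<le> (\<Sum>k<l. \<bar>x k - y k\<bar>)"
    if "x \<in> space (vec_space l)" "y \<in> space (vec_space l)" for x y
    using assms that by (auto simp: Lip1_def)
  \<comment> \<open>A 1-Lipschitz function is the infimum of the cones of slope 1 standing on its
    graph (McShane's formula). Cones over a dense set suffice, and a countable one makes the infimum
    measurable.\<close>
  have eq: "f x = (INF q\<in>R. f q + (\<Sum>k<l. \<bar>x k - q k\<bar>))" if x: "x \<in> space (vec_space l)" for x
  proof (rule antisym)
    have ne: "R \<noteq> {}"
      by (auto simp: R_def PiE_eq_empty_iff intro: Rats_0)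
    have lb: "f x \<le> f q + (\<Sum>k<l. \<bar>x k - q k\<bar>)" if "q \<in> R" for q
      using lip[OF x Rs[OF that]] by (simp add: abs_le_iff)
    then show "f x \<le> (INF q\<in>R. f q + (\<Sum>k<l. \<bar>x k - q k\<bar>))"
      by (intro cINF_greatest ne)
    show "(INF q\<in>R. f q + (\<Sum>k<l. \<bar>x k - q k\<bar>)) \<le> f x"
    proof (rule field_le_epsilon)
      fix e :: real assume "e > 0"
      \<comment> \<open>The distance to the rational vector is paid twice, once in
        \<open>f r\<close> and once in the cone, hence the 2; \<open>Suc l\<close> keeps the
        denominator positive for \<open>l = 0\<close>.\<close>
      define d where "d = e / (2 * real (Suc l))"
      have d: "d > 0" using \<open>e > 0\<close> by (simp add: d_def)
      have "\<exists>q\<in>\<rat>. \<bar>x k - q\<bar> \<le> d" for k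
      proof -
        obtain q where "q \<in> \<rat>" "x k < q" "q < x k + d"
          using Rats_dense_in_real[of "x k" "x k + d"] d by auto
        then show ?thesis by (intro bexI[of _ q]) auto
      qed
      then obtain q where q: "\<And>k. q k \<in> \<rat>" "\<And>k. \<bar>x k - q k\<bar> \<le> d" by metis
      define r where "r = restrict q {..<l}"
      have r: "r \<in> R" using q by (auto simp: r_def R_def)
      have "(\<Sum>k<l. \<bar>x k - r k\<bar>) \<le> (\<Sum>k<l. d)"
        by (intro sum_mono) (auto simp: r_def q)
      also have "\<dots> \<le> real (Suc l) * d" using d by simp
      also have "\<dots> = e / 2" by (simp add: d_def field_simps)
      finally have s: "(\<Sum>k<l. \<bar>x k - r k\<bar>) \<le> e / 2" .
      have "(INF q\<in>R. f q + (\<Sum>k<l. \<bar>x k - q k\<bar>)) \<le> f r + (\<Sum>k<l. \<bar>x k - r k\<bar>)"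
        by (rule cINF_lower[OF _ r]) (auto intro!: bdd_belowI[of _ "f x"] lb)
      also have "\<dots> \<le> f x + e"
        using lip[OF x Rs[OF r]] s by (simp add: abs_le_iff)
      finally show "(INF q\<in>R. f q + (\<Sum>k<l. \<bar>x k - q k\<bar>)) \<le> f x + e" .
    qed
  qed
  have "(\<lambda>x. INF q\<in>R. f q + (\<Sum>k<l. \<bar>x k - q k\<bar>)) \<in> borel_measurable (vec_space l)"
    by (intro borel_measurable_cINF_real R) measurable
  then show ?thesis
    by (subst measurable_cong[OF eq])
qed

lemma measurable_pair_measure_countable2:
  fixes f :: "'a \<times> 'c::countable \<Rightarrow> 'b"
  assumes "\<And>c. (\<lambda>x. f (x, c)) \<in> measurable N K"
  shows "f \<in> measurable (N \<Otimes>\<^sub>M count_space UNIV) K"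
proof -
  have "(\<lambda>x. f (fst x, c)) \<in> measurable (N \<Otimes>\<^sub>M count_space UNIV) K" for c
    by (rule measurable_compose[OF measurable_fst assms])
  then have "(\<lambda>x. f (fst x, snd x)) \<in> measurable (N \<Otimes>\<^sub>M count_space UNIV) K"
    by (rule measurable_compose_countable) (rule measurable_snd)
  then show ?thesis by simp
qed

text \<open>With countably many values, the conditional probabilities of single points form a
  density with respect to counting measure. Every function \<open>h\<close> of the value is
  measurable here, so the one disintegration identity serves for events, marginals, moments and
  distances alike.\<close>

lemma (in prob_space) discrete_cond_kernel:
  fixes W :: "'a \<Rightarrow> 'c::countable"
  assumes F: "subalgebra M F" and W: "W \<in> measurable M (count_space UNIV)"
  obtains \<kappa> where "\<kappa> \<in> measurable F (prob_algebra (count_space UNIV))"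
    and "\<And>B h. B \<in> sets F \<Longrightarrow>
      (\<integral>\<^sup>+\<omega>\<in>B. (\<integral>\<^sup>+c. h c \<partial>\<kappa> \<omega>) \<partial>M) = (\<integral>\<^sup>+\<omega>\<in>B. h (W \<omega>) \<partial>M)"
proof -
  interpret finite_measure_subalgebra M F using F by unfold_locales
  interpret C: sigma_finite_measure "count_space (UNIV :: 'c set)"
    by (rule sigma_finite_measure_count_space_countable) simp
  interpret MC: pair_sigma_finite M "count_space (UNIV :: 'c set)" ..
  note [measurable] = W
  have FM: "f \<in> borel_measurable M" if "f \<in> borel_measurable F" for f :: "'a \<Rightarrow> ennreal"
    using measurable_from_subalg[OF F that] .
  have FMs: "B \<in> sets M" if "B \<in> sets F" for B
    using F that unfolding subalgebra_def by blast
  define G where "G c = nn_cond_exp M F (indicator (W -` {c} \<inter> space M))" for c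
  have GF[measurable]: "G c \<in> borel_measurable F" for c unfolding G_def by (rule borel_measurable_nn_cond_exp)
  have GM[measurable]: "G c \<in> borel_measurable M" for c by (rule FM[OF GF])
  have HF: "(\<lambda>\<omega>. \<integral>\<^sup>+c. h c * G c \<omega> \<partial>count_space UNIV) \<in> borel_measurable F" for h
    by (rule C.borel_measurable_nn_integral)
       (rule measurable_pair_measure_countable2, simp)
  \<comment> \<open>Tonelli against counting measure brings the sum over the values outside, where
    the defining property of conditional expectation applies to each value separately, and then back
    inside.\<close>
  have H: "(\<integral>\<^sup>+\<omega>\<in>B. (\<integral>\<^sup>+c. h c * G c \<omega> \<partial>count_space UNIV) \<partial>M) = (\<integral>\<^sup>+\<omega>\<in>B. h (W \<omega>) \<partial>M)"
    if B: "B \<in> sets F" for B h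
  proof -
    note [measurable] = FMs[OF B] B
    have W1: "(\<integral>\<^sup>+c. h c * indicator (W -` {c} \<inter> space M) \<omega> \<partial>count_space UNIV) = h (W \<omega>)"
      if "\<omega> \<in> space M" for \<omega>
    proof -
      have "(\<integral>\<^sup>+c. h c * indicator (W -` {c} \<inter> space M) \<omega> \<partial>count_space UNIV)
          = (\<integral>\<^sup>+c. h (W \<omega>) * indicator {W \<omega>} c \<partial>count_space UNIV)"
        using that by (intro nn_integral_cong) (auto split: split_indicator)
      then show ?thesis by (simp add: nn_integral_cmult_indicator)
    qed
    have "(\<integral>\<^sup>+\<omega>\<in>B. (\<integral>\<^sup>+c. h c * G c \<omega> \<partial>count_space UNIV) \<partial>M)
        = (\<integral>\<^sup>+\<omega>. (\<integral>\<^sup>+c. indicator B \<omega> * (h c * G c \<omega>) \<partial>count_space UNIV) \<partial>M)"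
      by (subst nn_integral_cmult) (auto simp: mult.commute)
    also have "\<dots> = (\<integral>\<^sup>+c. (\<integral>\<^sup>+\<omega>. indicator B \<omega> * (h c * G c \<omega>) \<partial>M) \<partial>count_space UNIV)"
      by (rule MC.Fubini'[symmetric])
         (rule measurable_pair_measure_countable2, simp)
    also have "\<dots> = (\<integral>\<^sup>+c. (\<integral>\<^sup>+\<omega>. indicator B \<omega> * (h c * indicator (W -` {c} \<inter> space M) \<omega>) \<partial>M) \<partial>count_space UNIV)"
    proof (rule nn_integral_cong)
      fix c
      have "(\<integral>\<^sup>+\<omega>. (h c * indicator B \<omega>) * G c \<omega> \<partial>M)
          = (\<integral>\<^sup>+\<omega>. (h c * indicator B \<omega>) * indicator (W -` {c} \<inter> space M) \<omega> \<partial>M)"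
        unfolding G_def by (rule nn_cond_exp_intg) auto
      then show "(\<integral>\<^sup>+\<omega>. indicator B \<omega> * (h c * G c \<omega>) \<partial>M)
          = (\<integral>\<^sup>+\<omega>. indicator B \<omega> * (h c * indicator (W -` {c} \<inter> space M) \<omega>) \<partial>M)"
        by (simp add: ac_simps)
    qed
    also have "\<dots> = (\<integral>\<^sup>+\<omega>. (\<integral>\<^sup>+c. indicator B \<omega> * (h c * indicator (W -` {c} \<inter> space M) \<omega>) \<partial>count_space UNIV) \<partial>M)"
      by (rule MC.Fubini')
         (rule measurable_pair_measure_countable2, simp)
    also have "\<dots> = (\<integral>\<^sup>+\<omega>\<in>B. h (W \<omega>) \<partial>M)"
      by (intro nn_integral_cong) (subst nn_integral_cmult, auto simp: W1 mult.commute)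
    finally show ?thesis .
  qed
  define T where "T \<omega> = (\<integral>\<^sup>+c. G c \<omega> \<partial>count_space UNIV)" for \<omega>
  have TF[measurable]: "T \<in> borel_measurable F"
    using HF[of "\<lambda>_. 1"] by (simp add: T_def[abs_def])
  \<comment> \<open>By \<open>H\<close> with \<open>h = 1\<close>, the total mass \<open>T\<close>
    is a version of the conditional expectation of the constant 1.\<close>
  have AT: "AE \<omega> in M. T \<omega> = 1"
  proof -
    have "AE \<omega> in M. T \<omega> = nn_cond_exp M F (\<lambda>_. 1) \<omega>"
      using H[of _ "\<lambda>_. 1"] by (intro nn_cond_exp_charact) (auto simp: T_def)
    moreover have "AE \<omega> in M. 1 = nn_cond_exp M F (\<lambda>_. 1) \<omega>"
      by (rule nn_cond_exp_F_meas) auto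
    ultimately show ?thesis by eventually_elim simp
  qed
  \<comment> \<open>\<open>prob_algebra\<close> demands a probability measure at every point, so a
    point mass is put on the null set where the density does not sum to 1.\<close>
  define \<kappa> where "\<kappa> \<omega> = (if T \<omega> = 1 then density (count_space UNIV) (\<lambda>c. G c \<omega>)
      else return (count_space UNIV) undefined)" for \<omega>
  have k1: "(\<integral>\<^sup>+c. h c \<partial>\<kappa> \<omega>) = (\<integral>\<^sup>+c. h c * G c \<omega> \<partial>count_space UNIV)" if "T \<omega> = 1" for \<omega> h
    using that by (simp add: \<kappa>_def nn_integral_density mult.commute)
  have sk: "sets (\<kappa> \<omega>) = UNIV" for \<omega> by (simp add: \<kappa>_def)
  show ?thesis
  proof
    show "\<kappa> \<in> measurable F (prob_algebra (count_space UNIV))"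
    proof (intro measurable_prob_algebraI measurable_subprob_algebra)
      show ps: "prob_space (\<kappa> \<omega>)" for \<omega>
      proof (cases "T \<omega> = 1")
        case True
        then show ?thesis
          by (intro prob_spaceI) (simp add: \<kappa>_def emeasure_density T_def)
      next
        case False
        then show ?thesis by (simp add: \<kappa>_def prob_space_return)
      qed
      show "subprob_space (\<kappa> \<omega>)" for \<omega>
        using ps[of \<omega>] by (rule prob_space_imp_subprob_space)
      show "(\<lambda>\<omega>. emeasure (\<kappa> \<omega>) A) \<in> borel_measurable F" for A
      proof -
        have "emeasure (\<kappa> \<omega>) A = (if T \<omega> = 1 then \<integral>\<^sup>+c. indicator A c * G c \<omega> \<partial>count_space UNIV
            else indicator A undefined)" for \<omega>
          by (auto simp: \<kappa>_def emeasure_density mult.commute)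
        then show ?thesis using HF[of "indicator A"] by simp
      qed
    qed (simp add: sk)
    show "(\<integral>\<^sup>+\<omega>\<in>B. (\<integral>\<^sup>+c. h c \<partial>\<kappa> \<omega>) \<partial>M) = (\<integral>\<^sup>+\<omega>\<in>B. h (W \<omega>) \<partial>M)" if B: "B \<in> sets F" for B h
    proof -
      have "(\<integral>\<^sup>+\<omega>\<in>B. (\<integral>\<^sup>+c. h c \<partial>\<kappa> \<omega>) \<partial>M) = (\<integral>\<^sup>+\<omega>\<in>B. (\<integral>\<^sup>+c. h c * G c \<omega> \<partial>count_space UNIV) \<partial>M)"
        using AT by (intro nn_integral_cong_AE) (auto simp: k1)
      then show ?thesis using H[OF B] by simp
    qed
  qed
qed


text \<open>A Lipschitz function grows at most linearly away from the origin \<open>o'\<close>, so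
  integrable coordinates dominate it.\<close>

lemma Lip1_integrable:
  assumes "finite_measure N" and f: "f \<in> Lip1 l" and u: "u \<in> measurable N (vec_space l)"
    and i: "\<And>k. k < l \<Longrightarrow> integrable N (\<lambda>x. u x k)"
  shows "integrable N (\<lambda>x. f (u x))"
proof -
  interpret finite_measure N by fact
  define o' :: "nat \<Rightarrow> real" where "o' = (\<lambda>k\<in>{..<l}. 0)"
  have o': "o' \<in> space (vec_space l)" by (simp add: o'_def space_PiM)
  show ?thesis
  proof (rule Bochner_Integration.integrable_bound)
    show "integrable N (\<lambda>x. \<bar>f o'\<bar> + (\<Sum>k<l. \<bar>u x k\<bar>))"
      by (intro Bochner_Integration.integrable_add Bochner_Integration.integrable_sum
          integrable_abs i) auto
    show "(\<lambda>x. f (u x)) \<in> borel_measurable N"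
      by (rule measurable_compose[OF u Lip1_measurable[OF f]])
    show "AE x in N. norm (f (u x)) \<le> norm (\<bar>f o'\<bar> + (\<Sum>k<l. \<bar>u x k\<bar>))"
    proof (rule AE_I2)
      fix x assume "x \<in> space N"
      then have "u x \<in> space (vec_space l)" using u by (rule measurable_space[rotated])
      then have "\<bar>f (u x) - f o'\<bar> \<le> (\<Sum>k<l. \<bar>u x k - o' k\<bar>)"
        using f o' by (auto simp: Lip1_def)
      also have "\<dots> = (\<Sum>k<l. \<bar>u x k\<bar>)" by (simp add: o'_def)
      finally show "norm (f (u x)) \<le> norm (\<bar>f o'\<bar> + (\<Sum>k<l. \<bar>u x k\<bar>))"
        by simp
    qed
  qed
qed

text \<open>The easy half of Kantorovich duality: any joint realisation of two vectors on one space
  bounds the distance of their laws as seen by Lipschitz functions.\<close>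

lemma Lip1_integral_diff:
  assumes N: "finite_measure N" and f: "f \<in> Lip1 l"
    and u: "u \<in> measurable N (vec_space l)" "\<And>k. k < l \<Longrightarrow> integrable N (\<lambda>x. u x k)"
    and v: "v \<in> measurable N (vec_space l)" "\<And>k. k < l \<Longrightarrow> integrable N (\<lambda>x. v x k)"
  shows "ennreal \<bar>(\<integral>x. f (u x) \<partial>N) - (\<integral>x. f (v x) \<partial>N)\<bar> \<le> (\<integral>\<^sup>+x. (\<Sum>k<l. ennreal \<bar>u x k - v x k\<bar>) \<partial>N)"
proof -
  note i = Lip1_integrable[OF N f u] Lip1_integrable[OF N f v]
  have "ennreal \<bar>(\<integral>x. f (u x) \<partial>N) - (\<integral>x. f (v x) \<partial>N)\<bar> = ennreal (norm (\<integral>x. f (u x) - f (v x) \<partial>N))"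
    using i by simp
  also have "\<dots> \<le> (\<integral>\<^sup>+x. ennreal (norm (f (u x) - f (v x))) \<partial>N)"
    using i by (intro integral_norm_bound_ennreal) auto
  also have "\<dots> \<le> (\<integral>\<^sup>+x. (\<Sum>k<l. ennreal \<bar>u x k - v x k\<bar>) \<partial>N)"
  proof (rule nn_integral_mono)
    fix x assume "x \<in> space N"
    then have "u x \<in> space (vec_space l)" "v x \<in> space (vec_space l)"
      using measurable_space[OF u(1)] measurable_space[OF v(1)] by auto
    then have "\<bar>f (u x) - f (v x)\<bar> \<le> (\<Sum>k<l. \<bar>u x k - v x k\<bar>)"
      using f by (auto simp: Lip1_def)
    then show "ennreal (norm (f (u x) - f (v x))) \<le> (\<Sum>k<l. ennreal \<bar>u x k - v x k\<bar>)"
      by (simp add: sum_ennreal ennreal_leI)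
  qed
  finally show ?thesis .
qed

text \<open>Everything being discrete, a conditional law \<open>\<kappa>\<close> of the pair \<open>(V, V')\<close> given \<open>F\<close> can be written
  down; its second marginal is almost surely the law of \<open>V'\<close>, so \<open>\<kappa>\<close> couples the conditional law of
  \<open>V\<close> with the unconditional law of \<open>V'\<close>.\<close>

lemma (in prob_space) tau_le:
  fixes V V' :: "'a \<Rightarrow> 'd::countable"
  assumes F: "subalgebra M F"
    and V: "V \<in> measurable M (count_space UNIV)" and V': "V' \<in> measurable M (count_space UNIV)"
    and \<phi>: "\<And>d. \<phi> d \<in> space (vec_space l)"
    and ind: "\<And>A d. A \<in> sets F \<Longrightarrow>
      prob (A \<inter> (V' -` {d} \<inter> space M)) = prob A * prob (V' -` {d} \<inter> space M)"
    and iV: "\<And>k. k < l \<Longrightarrow> integrable M (\<lambda>\<omega>. \<phi> (V \<omega>) k)"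
    and iV': "\<And>k. k < l \<Longrightarrow> integrable M (\<lambda>\<omega>. \<phi> (V' \<omega>) k)"
  shows "tau M F l (\<lambda>\<omega>. \<phi> (V \<omega>)) \<le> 2 * (\<integral>\<^sup>+\<omega>. (\<Sum>k<l. ennreal \<bar>\<phi> (V \<omega>) k - \<phi> (V' \<omega>) k\<bar>) \<partial>M)"
proof -
  interpret finite_measure_subalgebra M F using F by unfold_locales
  note [measurable] = V V'
  have FM: "f \<in> borel_measurable M" if "f \<in> borel_measurable F" for f :: "'a \<Rightarrow> ennreal"
    using measurable_from_subalg[OF F that] .
  have FMs: "B \<in> sets M" if "B \<in> sets F" for B
    using F that unfolding subalgebra_def by blast
  have sp: "space F = space M" using F unfolding subalgebra_def by blast
  have spF: "space M \<in> sets F" using sets.top[of F] sp by simp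
  have \<phi>m: "(\<lambda>x. \<phi> (g x)) \<in> measurable N (vec_space l)" if "g \<in> measurable N (count_space UNIV)" for g N
    by (rule measurable_compose[OF that]) (use \<phi> in auto)
  define W where "W \<omega> = (V \<omega>, V' \<omega>)" for \<omega>
  have W[measurable]: "W \<in> measurable M (count_space UNIV)"
  proof -
    have "W \<in> measurable M (count_space UNIV \<Otimes>\<^sub>M count_space UNIV)"
      unfolding W_def by measurable
    then show ?thesis by (simp add: pair_measure_countable)
  qed
  obtain \<kappa> where \<kappa>: "\<kappa> \<in> measurable F (prob_algebra (count_space UNIV))"
    and master: "\<And>B h. B \<in> sets F \<Longrightarrow>
      (\<integral>\<^sup>+\<omega>\<in>B. (\<integral>\<^sup>+c. h c \<partial>\<kappa> \<omega>) \<partial>M) = (\<integral>\<^sup>+\<omega>\<in>B. h (W \<omega>) \<partial>M)"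
    using discrete_cond_kernel[OF F W] by blast
  have total: "(\<integral>\<^sup>+\<omega>. (\<integral>\<^sup>+c. h c \<partial>\<kappa> \<omega>) \<partial>M) = (\<integral>\<^sup>+\<omega>. h (W \<omega>) \<partial>M)" for h
  proof -
    have "(\<integral>\<^sup>+\<omega>. (\<integral>\<^sup>+c. h c \<partial>\<kappa> \<omega>) \<partial>M) = (\<integral>\<^sup>+\<omega>\<in>space M. (\<integral>\<^sup>+c. h c \<partial>\<kappa> \<omega>) \<partial>M)"
      by (rule nn_integral_cong) simp
    also have "\<dots> = (\<integral>\<^sup>+\<omega>\<in>space M. h (W \<omega>) \<partial>M)" by (rule master[OF spF])
    also have "\<dots> = (\<integral>\<^sup>+\<omega>. h (W \<omega>) \<partial>M)" by (rule nn_integral_cong) simp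
    finally show ?thesis .
  qed
  have \<kappa>': "prob_space (\<kappa> \<omega>)" "sets (\<kappa> \<omega>) = UNIV" "space (\<kappa> \<omega>) = UNIV" if "\<omega> \<in> space M" for \<omega>
    using measurable_space[OF \<kappa>, of \<omega>] that sp
      sets_eq_imp_space_eq[of "\<kappa> \<omega>" "count_space UNIV"]
    by (auto simp: space_prob_algebra)
  have hm: "(\<lambda>\<omega>. \<integral>\<^sup>+c. h c \<partial>\<kappa> \<omega>) \<in> borel_measurable F" for h
    by (rule measurable_compose[OF measurable_prob_algebraD[OF \<kappa>]
          nn_integral_measurable_subprob_algebra]) simp
  have hM[measurable]: "(\<lambda>\<omega>. \<integral>\<^sup>+c. h c \<partial>\<kappa> \<omega>) \<in> borel_measurable M" for h
    by (rule FM[OF hm])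
  have Wm: "(\<lambda>\<omega>. h (W \<omega>)) \<in> borel_measurable M" for h :: "_ \<Rightarrow> ennreal"
    by (rule measurable_compose[OF W]) simp
  have cond: "AE \<omega> in M. (\<integral>\<^sup>+c. h c \<partial>\<kappa> \<omega>) = nn_cond_exp M F (\<lambda>\<omega>. h (W \<omega>)) \<omega>" for h
    by (rule nn_cond_exp_charact[OF _ Wm hm]) (simp add: master)
  have em: "emeasure (\<kappa> \<omega>) A = (\<integral>\<^sup>+c. indicator A c \<partial>\<kappa> \<omega>)" if "\<omega> \<in> space M" for \<omega> A
    using \<kappa>'[OF that] by simp
  \<comment> \<open>The kernel offered to \<open>tau\<close>: the first marginal of
    \<open>\<kappa>\<close>, carried from the countable codes to vectors by
    \<open>\<phi>\<close>.\<close>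
  define \<kappa>1 where "\<kappa>1 \<omega> = distr (\<kappa> \<omega>) (vec_space l) (\<lambda>c. \<phi> (fst c))" for \<omega>
  have m1: "(\<lambda>c. \<phi> (fst c)) \<in> measurable (\<kappa> \<omega>) (vec_space l)"
       "(\<lambda>c. \<phi> (snd c)) \<in> measurable (\<kappa> \<omega>) (vec_space l)" if "\<omega> \<in> space M" for \<omega>
    using \<kappa>'[OF that] \<phi> by (auto simp: measurable_def Pi_iff)
  have rcd: "regular_cond_distr M F (vec_space l) (\<lambda>\<omega>. \<phi> (V \<omega>)) \<kappa>1"
    unfolding regular_cond_distr_def
  proof (intro conjI ballI)
    show "\<kappa>1 \<in> measurable F (prob_algebra (vec_space l))"
      unfolding \<kappa>1_def
      by (rule measurable_compose[OF \<kappa> measurable_distr_prob_space]) (use \<phi> in auto)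
    fix A assume A: "A \<in> sets (vec_space l)"
    define A' where "A' = {c :: 'd \<times> 'd. \<phi> (fst c) \<in> A}"
    have YA: "(\<lambda>\<omega>. \<phi> (V \<omega>)) -` A \<inter> space M \<in> sets M"
      using measurable_sets[OF \<phi>m[OF V] A] .
    \<comment> \<open>\<open>real_cond_exp\<close> subtracts the conditional expectation of the
      negative part, which vanishes for an indicator.\<close>
    have neg: "(\<lambda>\<omega>. ennreal (- indicator ((\<lambda>\<omega>. \<phi> (V \<omega>)) -` A \<inter> space M) \<omega>)) = (\<lambda>_. 0)"
      by (auto simp: fun_eq_iff ennreal_neg)
    have "AE \<omega> in M. nn_cond_exp M F (\<lambda>\<omega>. indicator A' (W \<omega>)) \<omega>
        = nn_cond_exp M F (\<lambda>\<omega>. ennreal (indicator ((\<lambda>\<omega>. \<phi> (V \<omega>)) -` A \<inter> space M) \<omega>)) \<omega>"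
      using YA by (intro nn_cond_exp_cong AE_I2 Wm) (auto simp: A'_def W_def split: split_indicator)
    moreover have "AE \<omega> in M. 0 = nn_cond_exp M F (\<lambda>_. 0) \<omega>"
      by (rule nn_cond_exp_F_meas) simp
    ultimately show "AE \<omega> in M. measure (\<kappa>1 \<omega>) A
        = real_cond_exp M F (indicator ((\<lambda>\<omega>. \<phi> (V \<omega>)) -` A \<inter> space M)) \<omega>"
      using cond[of "indicator A'"] AE_space
    proof eventually_elim
      case (elim \<omega>)
      have "emeasure (\<kappa>1 \<omega>) A = emeasure (\<kappa> \<omega>) A'"
        unfolding \<kappa>1_def using \<kappa>'[OF elim(4)]
        by (subst emeasure_distr[OF m1(1)[OF elim(4)] A]) (auto simp: A'_def vimage_def)
      then have "measure (\<kappa>1 \<omega>) A = enn2real (nn_cond_exp M F (\<lambda>\<omega>. indicator A' (W \<omega>)) \<omega>)"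
        using elim(3) em[OF elim(4), of A'] by (simp add: measure_def)
      then show ?case
        using elim(1,2) neg by (simp add: real_cond_exp_def)
    qed
  qed
  \<comment> \<open>By independence the constant probability of \<open>V' = d\<close> is a version
    of its conditional probability given \<open>F\<close>. There are countably many
    \<open>d\<close>, so a single null set is discarded.\<close>
  have marg: "AE \<omega> in M. distr (\<kappa> \<omega>) (count_space UNIV) snd = distr M (count_space UNIV) V'"
  proof -
    have "AE \<omega> in M. emeasure (\<kappa> \<omega>) {c. snd c = d} = emeasure M (V' -` {d} \<inter> space M)" for d
    proof -
      have "AE \<omega> in M. emeasure M (V' -` {d} \<inter> space M)
          = nn_cond_exp M F (\<lambda>\<omega>. indicator {c. snd c = d} (W \<omega>)) \<omega>"
      proof (rule nn_cond_exp_charact[OF _ Wm])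
        fix A assume A: "A \<in> sets F"
        have "(\<integral>\<^sup>+\<omega>\<in>A. indicator {c. snd c = d} (W \<omega>) \<partial>M)
            = (\<integral>\<^sup>+\<omega>. indicator (A \<inter> (V' -` {d} \<inter> space M)) \<omega> \<partial>M)"
          by (rule nn_integral_cong) (auto simp: W_def split: split_indicator)
        also have "\<dots> = emeasure M (A \<inter> (V' -` {d} \<inter> space M))"
          using FMs[OF A] by simp
        also have "\<dots> = emeasure M (V' -` {d} \<inter> space M) * emeasure M A"
          using ind[OF A, of d] by (simp add: emeasure_eq_measure ennreal_mult'' mult.commute)
        also have "\<dots> = (\<integral>\<^sup>+\<omega>\<in>A. emeasure M (V' -` {d} \<inter> space M) \<partial>M)"
          using FMs[OF A] by (simp add: nn_integral_cmult_indicator)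
        finally show "(\<integral>\<^sup>+\<omega>\<in>A. indicator {c. snd c = d} (W \<omega>) \<partial>M)
            = (\<integral>\<^sup>+\<omega>\<in>A. emeasure M (V' -` {d} \<inter> space M) \<partial>M)" .
      qed simp
      then show ?thesis
        using cond[of "indicator {c. snd c = d}"] AE_space
        by eventually_elim (simp add: em)
    qed
    then have "AE \<omega> in M. \<forall>d. emeasure (\<kappa> \<omega>) {c. snd c = d} = emeasure M (V' -` {d} \<inter> space M)"
      by (simp add: AE_all_countable)
    then show ?thesis using AE_space
    proof eventually_elim
      case (elim \<omega>)
      have m: "snd \<in> measurable (\<kappa> \<omega>) (count_space UNIV)"
        using \<kappa>'[OF elim(2)] by (auto simp: measurable_def)
      show ?case
      proof (rule measure_eqI_countable[of _ UNIV])
        fix d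
        have "emeasure (distr (\<kappa> \<omega>) (count_space UNIV) snd) {d} = emeasure (\<kappa> \<omega>) {c. snd c = d}"
          using \<kappa>'[OF elim(2)] by (simp add: emeasure_distr[OF m] vimage_def)
        then show "emeasure (distr (\<kappa> \<omega>) (count_space UNIV) snd) {d}
            = emeasure (distr M (count_space UNIV) V') {d}"
          using elim(1) by (simp add: emeasure_distr)
      qed auto
    qed
  qed
  \<comment> \<open>Almost every conditional law of \<open>V\<close> has a first moment, which makes
    Lipschitz functions integrable under it.\<close>
  have fin: "AE \<omega> in M. (\<integral>\<^sup>+c. (\<Sum>k<l. ennreal \<bar>\<phi> (fst c) k\<bar>) \<partial>\<kappa> \<omega>) \<noteq> \<infinity>"
  proof (rule nn_integral_PInf_AE[OF hM])
    have "(\<integral>\<^sup>+\<omega>. (\<Sum>k<l. ennreal \<bar>\<phi> (V \<omega>) k\<bar>) \<partial>M) = (\<Sum>k<l. (\<integral>\<^sup>+\<omega>. ennreal \<bar>\<phi> (V \<omega>) k\<bar> \<partial>M))"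
      by (rule nn_integral_sum) (use iV in auto)
    also have "\<dots> \<noteq> \<infinity>"
      using iV by (auto simp: integrable_iff_bounded less_top)
    finally show "(\<integral>\<^sup>+\<omega>. (\<integral>\<^sup>+c. (\<Sum>k<l. ennreal \<bar>\<phi> (fst c) k\<bar>) \<partial>\<kappa> \<omega>) \<partial>M) \<noteq> \<infinity>"
      by (simp add: total W_def)
  qed
  define D where "D c = (\<Sum>k<l. ennreal \<bar>\<phi> (fst c) k - \<phi> (snd c) k\<bar>)" for c
  define \<delta> where "\<delta> = (\<integral>\<^sup>+\<omega>. (\<Sum>k<l. ennreal \<bar>\<phi> (V \<omega>) k - \<phi> (V' \<omega>) k\<bar>) \<partial>M)"
  have D: "(\<integral>\<^sup>+\<omega>. (\<integral>\<^sup>+c. D c \<partial>\<kappa> \<omega>) \<partial>M) = \<delta>"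
    by (simp add: total D_def \<delta>_def W_def)
  have fm: "finite_measure M" by unfold_locales
  have "tau M F l (\<lambda>\<omega>. \<phi> (V \<omega>)) \<le>
      (\<integral>\<^sup>+\<omega>. (SUP f \<in> Lip1 l. ennreal \<bar>(\<integral>y. f y \<partial>\<kappa>1 \<omega>) - (\<integral>\<omega>'. f (\<phi> (V \<omega>')) \<partial>M)\<bar>) \<partial>M)"
    unfolding tau_def by (rule INF_lower) (simp add: rcd)
  \<comment> \<open>The supremum runs over an uncountable family; it is bounded pointwise, outside
    one null set that serves all \<open>f\<close> at once.\<close>
  also have "\<dots> \<le> (\<integral>\<^sup>+\<omega>. (\<integral>\<^sup>+c. D c \<partial>\<kappa> \<omega>) + \<delta> \<partial>M)"
  proof (rule nn_integral_mono_AE)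
    show "AE \<omega> in M. (SUP f \<in> Lip1 l. ennreal \<bar>(\<integral>y. f y \<partial>\<kappa>1 \<omega>) - (\<integral>\<omega>'. f (\<phi> (V \<omega>')) \<partial>M)\<bar>)
        \<le> (\<integral>\<^sup>+c. D c \<partial>\<kappa> \<omega>) + \<delta>"
      using marg fin AE_space
    proof eventually_elim
      case (elim \<omega>)
      note k = \<kappa>'[OF elim(3)] and m = m1[OF elim(3)]
      interpret K: prob_space "\<kappa> \<omega>" by (rule k)
      have fk: "finite_measure (\<kappa> \<omega>)" by unfold_locales
      have km: "g \<in> measurable (\<kappa> \<omega>) (count_space UNIV)" for g :: "_ \<Rightarrow> 'x"
        using k by (auto simp: measurable_def)
      have kb: "g \<in> borel_measurable (\<kappa> \<omega>)" for g :: "_ \<Rightarrow> real"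
        using k by (auto simp: measurable_def)
      have i1: "integrable (\<kappa> \<omega>) (\<lambda>c. \<phi> (fst c) j)" if j: "j < l" for j
      proof (rule integrableI_bounded[OF kb])
        have "(\<integral>\<^sup>+c. ennreal (norm (\<phi> (fst c) j)) \<partial>\<kappa> \<omega>) \<le> (\<integral>\<^sup>+c. (\<Sum>k<l. ennreal \<bar>\<phi> (fst c) k\<bar>) \<partial>\<kappa> \<omega>)"
          using j by (intro nn_integral_mono) (auto intro!: member_le_sum)
        also have "\<dots> < \<infinity>" using elim(2) by (simp add: less_top)
        finally show "(\<integral>\<^sup>+c. ennreal (norm (\<phi> (fst c) j)) \<partial>\<kappa> \<omega>) < \<infinity>" .
      qed
      have i2: "integrable (\<kappa> \<omega>) (\<lambda>c. \<phi> (snd c) j)" if j: "j < l" for j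
      proof -
        have "integrable (distr M (count_space UNIV) V') (\<lambda>d. \<phi> d j)"
          using iV'[OF j] by (subst integrable_distr_eq) auto
        then have "integrable (distr (\<kappa> \<omega>) (count_space UNIV) snd) (\<lambda>d. \<phi> d j)"
          using elim(1) by simp
        then show ?thesis by (subst (asm) integrable_distr_eq[OF km]) auto
      qed
      show ?case
      proof (rule SUP_least)
        fix f assume f: "f \<in> Lip1 l"
        have e1: "(\<integral>y. f y \<partial>\<kappa>1 \<omega>) = (\<integral>c. f (\<phi> (fst c)) \<partial>\<kappa> \<omega>)"
          unfolding \<kappa>1_def by (rule integral_distr[OF m(1) Lip1_measurable[OF f]])
        have e2: "(\<integral>c. f (\<phi> (snd c)) \<partial>\<kappa> \<omega>) = (\<integral>\<omega>'. f (\<phi> (V' \<omega>')) \<partial>M)"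
        proof -
          have "(\<integral>c. f (\<phi> (snd c)) \<partial>\<kappa> \<omega>) = (\<integral>d. f (\<phi> d) \<partial>distr (\<kappa> \<omega>) (count_space UNIV) snd)"
            by (rule integral_distr[OF km, symmetric]) simp
          also have "\<dots> = (\<integral>d. f (\<phi> d) \<partial>distr M (count_space UNIV) V')" using elim(1) by simp
          also have "\<dots> = (\<integral>\<omega>'. f (\<phi> (V' \<omega>')) \<partial>M)" by (rule integral_distr[OF V']) simp
          finally show ?thesis .
        qed
        have d1: "ennreal \<bar>(\<integral>c. f (\<phi> (fst c)) \<partial>\<kappa> \<omega>) - (\<integral>c. f (\<phi> (snd c)) \<partial>\<kappa> \<omega>)\<bar> \<le> (\<integral>\<^sup>+c. D c \<partial>\<kappa> \<omega>)"
          unfolding D_def by (rule Lip1_integral_diff[OF fk f m(1) i1 m(2) i2])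
        have d2: "ennreal \<bar>(\<integral>\<omega>'. f (\<phi> (V \<omega>')) \<partial>M) - (\<integral>\<omega>'. f (\<phi> (V' \<omega>')) \<partial>M)\<bar> \<le> \<delta>"
          unfolding \<delta>_def by (rule Lip1_integral_diff[OF fm f \<phi>m[OF V] iV \<phi>m[OF V'] iV'])
        \<comment> \<open>Triangle inequality through the law of \<open>V'\<close>, which by
          \<open>e2\<close> is the same conditionally and unconditionally. The first difference is
          charged to the conditional coupling, the second to the unconditional one.\<close>
        have "ennreal \<bar>(\<integral>y. f y \<partial>\<kappa>1 \<omega>) - (\<integral>\<omega>'. f (\<phi> (V \<omega>')) \<partial>M)\<bar>
           \<le> ennreal (\<bar>(\<integral>c. f (\<phi> (fst c)) \<partial>\<kappa> \<omega>) - (\<integral>c. f (\<phi> (snd c)) \<partial>\<kappa> \<omega>)\<bar>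
              + \<bar>(\<integral>\<omega>'. f (\<phi> (V \<omega>')) \<partial>M) - (\<integral>\<omega>'. f (\<phi> (V' \<omega>')) \<partial>M)\<bar>)"
          unfolding e1 e2 by (rule ennreal_leI) linarith
        also have "\<dots> \<le> (\<integral>\<^sup>+c. D c \<partial>\<kappa> \<omega>) + \<delta>"
          using add_mono[OF d1 d2] by simp
        finally show "ennreal \<bar>(\<integral>y. f y \<partial>\<kappa>1 \<omega>) - (\<integral>\<omega>'. f (\<phi> (V \<omega>')) \<partial>M)\<bar> \<le> (\<integral>\<^sup>+c. D c \<partial>\<kappa> \<omega>) + \<delta>" .
      qed
    qed
  qed
  also have "\<dots> = 2 * \<delta>"
    by (subst nn_integral_add) (auto simp: D emeasure_space_1 mult_2)
  finally show ?thesis unfolding \<delta>_def .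
qed

section \<open>Ergodicity of Bernoulli shifts\<close>


text \<open>The domination \<open>N n \<le> M\<close> is what lets the limit pass through countable disjoint unions (Tannery).\<close>

lemma (in prob_space) tendsto_measure_generator:
  fixes N :: "nat \<Rightarrow> 'a measure"
  assumes G: "Int_stable G" "G \<subseteq> Pow (space M)" "sets M = sigma_sets (space M) G"
    and N: "\<And>n. finite_measure (N n)" "\<And>n. sets (N n) = sets M"
      "\<And>n A. A \<in> sets M \<Longrightarrow> measure (N n) A \<le> measure M A"
    and b: "\<And>A. A \<in> G \<Longrightarrow> (\<lambda>n. measure (N n) A) \<longlonglongrightarrow> measure M A * \<beta>"
    and t: "(\<lambda>n. measure (N n) (space M)) \<longlonglongrightarrow> \<beta>"
    and A: "A \<in> sets M"
  shows "(\<lambda>n. measure (N n) A) \<longlonglongrightarrow> measure M A * \<beta>"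
proof -
  have sp: "space (N n) = space M" for n by (rule sets_eq_imp_space_eq[OF N(2)])
  have "A \<in> sigma_sets (space M) G" using A G(3) by simp
  with G(1,2) show ?thesis
  proof (induction rule: sigma_sets_induct_disjoint)
    case (basic A)
    then show ?case by (rule b)
  next
    case empty
    show ?case by simp
  next
    case (compl A)
    then have A: "A \<in> sets M" using G(3) by simp
    have "measure (N n) (space M - A) = measure (N n) (space M) - measure (N n) A" for n
      using finite_measure.finite_measure_compl[OF N(1), of A n] A by (simp add: N(2) sp)
    moreover have "measure M (space M - A) * \<beta> = \<beta> - measure M A * \<beta>"
      by (simp only: prob_compl[OF A] left_diff_distrib mult_1)
    ultimately show ?case using tendsto_diff[OF t compl.IH] by simp
  next
    case (union A)
    then have A: "range A \<subseteq> sets M" using G(3) by simp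
    have s: "(\<lambda>i. measure M (A i)) sums measure M (\<Union>i. A i)"
      by (rule finite_measure_UNION[OF A union.hyps(1)])
    have "measure (N n) (\<Union>i. A i) = (\<Sum>i. measure (N n) (A i))" for n
      using finite_measure.finite_measure_UNION[OF N(1), of A n] A union.hyps(1)
      by (simp add: N(2) sums_iff)
    moreover have "(\<lambda>n. \<Sum>i. measure (N n) (A i)) \<longlonglongrightarrow> (\<Sum>i. measure M (A i) * \<beta>)"
    proof (rule tannerys_theorem[THEN conjunct2, THEN conjunct2])
      show "\<forall>\<^sub>F (k, n) in at_top \<times>\<^sub>F sequentially. norm (measure (N n) (A k)) \<le> measure M (A k)"
        using A N(3) by (intro always_eventually) auto
      show "summable (\<lambda>k. measure M (A k))" using s by (simp add: sums_iff)
    qed (use union.IH in auto)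
    moreover have "(\<Sum>i. measure M (A i) * \<beta>) = measure M (\<Union>i. A i) * \<beta>"
      using sums_unique[OF sums_mult2[OF s, of \<beta>]] by simp
    ultimately show ?case by simp
  qed
qed

lemma distr_PiM_shift:
  assumes "prob_space D"
  shows "distr (Pi\<^sub>M UNIV (\<lambda>_::int. D)) (Pi\<^sub>M UNIV (\<lambda>_. D)) (\<lambda>\<nu> t. \<nu> (t + h)) = Pi\<^sub>M UNIV (\<lambda>_. D)"
  using distr_PiM_reindex[of UNIV "\<lambda>_. D" "\<lambda>t. t + h" UNIV] assms by (simp add: inj_def restrict_def)

section \<open>Mixing of the two-sided Bernoulli shift and of its equivariant images\<close>

context
  fixes D :: "'d measure"
  assumes D: "prob_space D"
begin

interpretation D: prob_space D by (rule D)
interpretation C: product_prob_space "\<lambda>_. D" "UNIV :: int set" ..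

private abbreviation (input) "C \<equiv> Pi\<^sub>M (UNIV :: int set) (\<lambda>_. D)"

lemma shift_measurable: "(\<lambda>\<nu> t. \<nu> (t + h)) \<in> measurable C C"
  by (intro measurable_PiM_single') (auto simp: space_PiM PiE_def)

text \<open>Cylinders depend on finitely many coordinates. Once the shift exceeds all differences of
  their indices, the two coordinate sets are disjoint and the product formula is exact, so the
  sequence is eventually constant.\<close>

lemma cylinder_mixing:
  assumes "A \<in> prod_algebra UNIV (\<lambda>_::int. D)" "B \<in> prod_algebra UNIV (\<lambda>_::int. D)"
  shows "(\<lambda>n. measure C (A \<inter> ((\<lambda>\<nu> t. \<nu> (t + int n)) -` B \<inter> space C))) \<longlonglongrightarrow> measure C A * measure C B"
proof -
  have repr: "prod_emb UNIV (\<lambda>_. D) J (\<Pi>\<^sub>E j\<in>J. E j) = {\<nu> \<in> space C. \<forall>j\<in>J. \<nu> j \<in> E j}" for J :: "int set" and E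
    by (auto simp: prod_emb_def space_PiM PiE_iff)
  have meas: "measure C {\<nu> \<in> space C. \<forall>j\<in>J. \<nu> j \<in> E j} = (\<Prod>j\<in>J. measure D (E j))"
    if "finite J" "\<And>j. j \<in> J \<Longrightarrow> E j \<in> sets D" for J E
    using C.measure_PiM_emb[of J E] that by (simp add: repr)
  have cyl: "\<exists>J E. finite J \<and> (\<forall>i\<in>J. E i \<in> sets D) \<and> A = {\<nu> \<in> space C. \<forall>j\<in>J. \<nu> j \<in> E j}"
    if "A \<in> prod_algebra UNIV (\<lambda>_::int. D)" for A
  proof (rule prod_algebraE[OF that])
    fix J E
    assume "A = prod_emb UNIV (\<lambda>_. D) J (\<Pi>\<^sub>E j\<in>J. E j)" "finite J" "\<And>i. i \<in> J \<Longrightarrow> E i \<in> sets D"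
    then show ?thesis unfolding repr by blast
  qed
  obtain J E where J: "finite J" "\<And>i. i \<in> J \<Longrightarrow> E i \<in> sets D"
    and A: "A = {\<nu> \<in> space C. \<forall>j\<in>J. \<nu> j \<in> E j}"
    using cyl[OF assms(1)] by blast
  obtain K F where K: "finite K" "\<And>i. i \<in> K \<Longrightarrow> F i \<in> sets D"
    and B: "B = {\<nu> \<in> space C. \<forall>j\<in>K. \<nu> j \<in> F j}"
    using cyl[OF assms(2)] by blast
  obtain m where m: "\<And>j k. j \<in> J \<Longrightarrow> k \<in> K \<Longrightarrow> j - k < int m"
  proof -
    have "finite ((\<lambda>(j,k). j - k) ` (J \<times> K))" using J K by simp
    then obtain m where "\<forall>x\<in>(\<lambda>(j,k). j - k) ` (J \<times> K). x < m"
      by (metis finite_nat_set_iff_bounded bdd_above_finite bdd_above_def le_less_trans less_add_one)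
    then show ?thesis by (intro that[of "nat m"]) force
  qed
  have "measure C (A \<inter> ((\<lambda>\<nu> t. \<nu> (t + int n)) -` B \<inter> space C)) = measure C A * measure C B" if "n \<ge> m" for n
  proof -
    let ?K = "(\<lambda>k. k + int n) ` K"
    have disj: "J \<inter> ?K = {}" using m that by force
    \<comment> \<open>One family of sides for the intersection of both cylinders;
      \<open>i - int n\<close> undoes the shift on the indices coming from \<open>K\<close>.\<close>
    define H where "H i = (if i \<in> J then E i else F (i - int n))" for i
    have "A \<inter> ((\<lambda>\<nu> t. \<nu> (t + int n)) -` B \<inter> space C) = {\<nu> \<in> space C. \<forall>j\<in>J \<union> ?K. \<nu> j \<in> H j}"
    proof -
      have "j + int n \<notin> J" if "j \<in> K" for j using disj that by blast
      then have "(\<forall>j\<in>J \<union> ?K. \<nu> j \<in> H j) \<longleftrightarrow> (\<forall>j\<in>J. \<nu> j \<in> E j) \<and> (\<forall>j\<in>K. \<nu> (j + int n) \<in> F j)" for \<nu>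
        by (simp add: H_def ball_Un)
      then show ?thesis
        using measurable_space[OF shift_measurable, of _ "int n"] by (auto simp: A B)
    qed
    also have "measure C \<dots> = (\<Prod>j\<in>J \<union> ?K. measure D (H j))"
      by (rule meas) (use J K disj in \<open>auto simp: H_def\<close>)
    also have "\<dots> = (\<Prod>j\<in>J. measure D (H j)) * (\<Prod>j\<in>?K. measure D (H j))"
      using J K disj by (intro prod.union_disjoint) auto
    also have "(\<Prod>j\<in>?K. measure D (H j)) = (\<Prod>k\<in>K. measure D (F k))"
    proof (subst prod.reindex)
      show "inj_on (\<lambda>k. k + int n) K" by (auto simp: inj_on_def)
      show "prod ((\<lambda>j. measure D (H j)) \<circ> (\<lambda>k. k + int n)) K = (\<Prod>k\<in>K. measure D (F k))"
        using disj by (intro prod.cong) (auto simp: H_def)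
    qed
    also have "(\<Prod>j\<in>J. measure D (H j)) = (\<Prod>j\<in>J. measure D (E j))"
      by (intro prod.cong) (auto simp: H_def)
    finally show ?thesis by (simp add: A B meas[OF J] meas[OF K])
  qed
  then show ?thesis
    by (intro tendsto_eventually eventually_sequentiallyI)
qed

text \<open>Mixing is extended from cylinders to measurable sets one argument at a time, by
  \<open>tendsto_measure_generator\<close>. The other set is frozen inside a measure dominated by
  \<open>C\<close>: first the restriction of \<open>C\<close> to the shifted cylinder, then the
  shift image of the restriction of \<open>C\<close> to \<open>A\<close>, which is dominated because
  the shift preserves \<open>C\<close>.\<close>

lemma shift_mixing:
  assumes A: "A \<in> sets C" and B: "B \<in> sets C"
  shows "(\<lambda>n. measure C (A \<inter> ((\<lambda>\<nu> t. \<nu> (t + int n)) -` B \<inter> space C))) \<longlonglongrightarrow> measure C A * measure C B"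
proof -
  define S where "S n B = (\<lambda>\<nu> t. \<nu> (t + int n)) -` B \<inter> space C" for n and B :: "(int \<Rightarrow> 'd) set"
  have Sm: "S n B \<in> sets C" if "B \<in> sets C" for n B
    unfolding S_def by (rule measurable_sets[OF shift_measurable that])
  have Sp: "measure C (S n B) = measure C B" if "B \<in> sets C" for n B
    unfolding S_def using measure_distr[OF shift_measurable that, of "int n"]
    by (simp add: distr_PiM_shift[OF D])
  have dens: "measure (density C (indicator E)) F = measure C (E \<inter> F)"
    if "E \<in> sets C" "F \<in> sets C" for E F
    using that by (simp add: measure_def emeasure_restricted)
  have densf: "finite_measure (density C (indicator E))" if "E \<in> sets C" for E
    using that by (intro finite_measureI) (simp add: emeasure_restricted)
  define G where "G = prod_algebra UNIV (\<lambda>_::int. D)"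
  have sC: "space C = (\<Pi>\<^sub>E i\<in>UNIV. space D)" by (simp add: space_PiM)
  have G: "Int_stable G" "G \<subseteq> Pow (space C)" "sets C = sigma_sets (space C) G"
    unfolding G_def sC using prod_algebra_sets_into_space[of UNIV "\<lambda>_. D"]
    by (auto simp: Int_stable_prod_algebra sets_PiM)
  have GC: "E \<in> sets C" if "E \<in> G" for E using that G(3) by (simp add: sigma_sets.Basic)
  have step1: "(\<lambda>n. measure C (A \<inter> S n B)) \<longlonglongrightarrow> measure C A * measure C B"
    if A: "A \<in> sets C" and B: "B \<in> G" for A B
  proof -
    let ?N = "\<lambda>n. density C (indicator (S n B))"
    have "(\<lambda>n. measure (?N n) A) \<longlonglongrightarrow> measure C A * measure C B"
    proof (rule C.tendsto_measure_generator[OF G])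
      show "finite_measure (?N n)" for n by (rule densf[OF Sm[OF GC[OF B]]])
      show "measure (?N n) F \<le> measure C F" if "F \<in> sets C" for n F
        using that by (simp add: dens Sm GC[OF B] C.finite_measure_mono)
      show "(\<lambda>n. measure (?N n) F) \<longlonglongrightarrow> measure C F * measure C B" if "F \<in> G" for F
      proof -
        have "measure (?N n) F = measure C (F \<inter> S n B)" for n
          using GC[OF that] GC[OF B] by (simp add: dens Sm Int_commute)
        then show ?thesis
          using cylinder_mixing[of F B] that B unfolding G_def S_def by simp
      qed
      show "(\<lambda>n. measure (?N n) (space C)) \<longlonglongrightarrow> measure C B"
        using GC[OF B] Sm[OF GC[OF B]] by (simp add: dens Sp sets.Int_space_eq2)
    qed (use A in auto)
    then show ?thesis using A GC[OF B] by (simp add: dens Sm Int_commute)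
  qed
  let ?N = "\<lambda>n. distr (density C (indicator A)) C (\<lambda>\<nu> t. \<nu> (t + int n))"
  have m: "(\<lambda>\<nu> t. \<nu> (t + int n)) \<in> measurable (density C (indicator A)) C" for n
    using shift_measurable by simp
  have N: "measure (?N n) F = measure C (A \<inter> S n F)" if "F \<in> sets C" for n F
    using that A Sm[OF that, of n] by (simp add: measure_distr[OF m] S_def[symmetric] dens)
  have "(\<lambda>n. measure (?N n) B) \<longlonglongrightarrow> measure C B * measure C A"
  proof (rule C.tendsto_measure_generator[OF G])
    show "finite_measure (?N n)" for n
      by (rule finite_measure.finite_measure_distr[OF densf[OF A] m])
    show "measure (?N n) F \<le> measure C F" if "F \<in> sets C" for n F
      using C.finite_measure_mono[of "A \<inter> S n F" "S n F"] Sm[OF that] Sp[OF that] N[OF that]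
      by simp
    show "(\<lambda>n. measure (?N n) F) \<longlonglongrightarrow> measure C F * measure C A" if "F \<in> G" for F
      using step1[OF A that] N[OF GC[OF that]] by (simp add: mult.commute)
    have "S n (space C) = space C" for n
      using measurable_space[OF shift_measurable] by (auto simp: S_def)
    then show "(\<lambda>n. measure (?N n) (space C)) \<longlonglongrightarrow> measure C A"
      using A by (simp add: N sets.Int_space_eq2)
  qed (use B in auto)
  then show ?thesis using B by (simp add: N S_def mult.commute)
qed

text \<open>An invariant set is asymptotically independent of its own shifts, which are all equal to it.\<close>

lemma shift_invariant_0_1:
  assumes A: "A \<in> sets C" and inv: "(\<lambda>\<nu> t. \<nu> (t + 1)) -` A \<inter> space C = A"
  shows "measure C A = 0 \<or> measure C A = 1"
proof -
  have i: "\<nu> \<in> A \<longleftrightarrow> (\<lambda>t. \<nu> (t + 1)) \<in> A" if "\<nu> \<in> space C" for \<nu>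
    using inv that by blast
  have "\<nu> \<in> A \<longleftrightarrow> (\<lambda>t. \<nu> (t + int n)) \<in> A" if "\<nu> \<in> space C" for \<nu> n
  proof (induction n)
    case (Suc n)
    have "(\<lambda>t. \<nu> (t + int n)) \<in> space C"
      using measurable_space[OF shift_measurable that] .
    from i[OF this] Suc show ?case by (simp add: ac_simps)
  qed simp
  then have "A \<inter> ((\<lambda>\<nu> t. \<nu> (t + int n)) -` A \<inter> space C) = A" for n
    using sets.sets_into_space[OF A] by blast
  then have "(\<lambda>n::nat. measure C A) \<longlonglongrightarrow> measure C A * measure C A"
    using shift_mixing[OF A A] by simp
  then have "measure C A = measure C A * measure C A"
    by (simp add: LIMSEQ_const_iff)
  then show ?thesis by simp
qed

text \<open>By equivariance, shifting the image path amounts to shifting the noise. Hence the image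
  law is invariant, and a shift-invariant set of paths pulls back to a shift-invariant set of noise,
  which has measure 0 or 1.\<close>

lemma factor_stationary_ergodic:
  assumes N: "N \<in> measurable Q C" and law: "distr Q C N = C"
    and G: "\<And>t. G t \<in> measurable C S"
    and eqv: "\<And>\<nu> t h. \<nu> \<in> space C \<Longrightarrow> G (t + h) \<nu> = G t (\<lambda>s. \<nu> (s + h))"
  shows "stationary Q S (\<lambda>t \<omega>. G t (N \<omega>))" and "ergodic Q S (\<lambda>t \<omega>. G t (N \<omega>))"
proof -
  let ?S = "Pi\<^sub>M UNIV (\<lambda>_::int. S)"
  have Gm: "(\<lambda>\<nu> t. G (t + h) \<nu>) \<in> measurable C ?S" for h
    using measurable_space[OF G] by (intro measurable_PiM_single' G) (auto simp: space_PiM)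
  have Gm0: "(\<lambda>\<nu> t. G t \<nu>) \<in> measurable C ?S" using Gm[of 0] by simp
  have pl: "path_law Q S (\<lambda>t \<omega>. G (t + h) (N \<omega>)) = distr C ?S (\<lambda>\<nu> t. G (t + h) \<nu>)" for h
    unfolding path_law_def using distr_distr[OF Gm N, of h] law by (simp add: comp_def)
  have pl0: "path_law Q S (\<lambda>t \<omega>. G t (N \<omega>)) = distr C ?S (\<lambda>\<nu> t. G t \<nu>)"
    using pl[of 0] by simp
  have eq: "distr C ?S (\<lambda>\<nu> t. G (t + h) \<nu>) = distr C ?S (\<lambda>\<nu> t. G t \<nu>)" for h
  proof -
    have "distr C ?S (\<lambda>\<nu> t. G (t + h) \<nu>) = distr C ?S ((\<lambda>\<nu> t. G t \<nu>) \<circ> (\<lambda>\<nu> t. \<nu> (t + h)))"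
      by (intro distr_cong) (auto simp: eqv)
    also have "\<dots> = distr (distr C C (\<lambda>\<nu> t. \<nu> (t + h))) ?S (\<lambda>\<nu> t. G t \<nu>)"
      by (rule distr_distr[OF Gm0 shift_measurable, symmetric])
    finally show ?thesis by (simp add: distr_PiM_shift[OF D])
  qed
  show "stationary Q S (\<lambda>t \<omega>. G t (N \<omega>))"
    unfolding stationary_def using measurable_compose[OF N G] pl pl0 eq by simp
  show "ergodic Q S (\<lambda>t \<omega>. G t (N \<omega>))"
    unfolding ergodic_def
  proof (intro ballI impI)
    fix A assume A: "A \<in> sets ?S" and inv: "(\<lambda>x t. x (t + 1)) -` A \<inter> space ?S = A"
    define A' where "A' = (\<lambda>\<nu> t. G t \<nu>) -` A \<inter> space C"
    have A': "A' \<in> sets C" unfolding A'_def by (rule measurable_sets[OF Gm0 A])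
    have i: "x \<in> A \<longleftrightarrow> (\<lambda>t. x (t + 1)) \<in> A" if "x \<in> space ?S" for x
      using inv that by blast
    have "(\<lambda>\<nu> t. \<nu> (t + 1)) -` A' \<inter> space C = A'"
    proof -
      have "(\<lambda>t. \<nu> (t + 1)) \<in> A' \<longleftrightarrow> \<nu> \<in> A'" if \<nu>: "\<nu> \<in> space C" for \<nu>
      proof -
        have e: "(\<lambda>t. G t (\<lambda>s. \<nu> (s + 1))) = (\<lambda>t. G (t + 1) \<nu>)"
          using eqv[OF \<nu>] by (intro ext) simp
        show ?thesis
          using \<nu> measurable_space[OF shift_measurable \<nu>, of 1] i[OF measurable_space[OF Gm0 \<nu>]]
          unfolding A'_def vimage_def Int_iff mem_Collect_eq e by blast
      qed
      then show ?thesis using sets.sets_into_space[OF A'] by blast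
    qed
    from shift_invariant_0_1[OF A' this]
    show "measure (path_law Q S (\<lambda>t \<omega>. G t (N \<omega>))) A = 0 \<or>
        measure (path_law Q S (\<lambda>t \<omega>. G t (N \<omega>))) A = 1"
      by (simp add: pl0 measure_distr[OF Gm0 A] A'_def)
  qed
qed

end

text \<open>This joins a given i.i.d. sequence on an arbitrary space with fresh randomization into
  one i.i.d. path. For fixed \<open>\<omega>\<close> a cylinder has a product of slices as its
  probability; independence of the \<open>X i\<close> pulls the integral over \<open>P\<close> into
  the product, and Fubini in each coordinate reassembles the sides.\<close>

lemma distr_pair_PiM_iid:
  fixes X :: "'i \<Rightarrow> 'w \<Rightarrow> 'x" and E :: "'x measure" and R :: "'z measure"
  assumes P: "prob_space P" and R: "prob_space R"
    and X: "prob_space.indep_vars P (\<lambda>_. E) X UNIV" and E: "\<And>i. distr P E (X i) = E"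
  shows "(\<lambda>(\<omega>, u) i. (X i \<omega>, u i)) \<in> measurable (P \<Otimes>\<^sub>M Pi\<^sub>M UNIV (\<lambda>_. R)) (Pi\<^sub>M UNIV (\<lambda>_. E \<Otimes>\<^sub>M R))"
    and "distr (P \<Otimes>\<^sub>M Pi\<^sub>M UNIV (\<lambda>_. R)) (Pi\<^sub>M UNIV (\<lambda>_. E \<Otimes>\<^sub>M R)) (\<lambda>(\<omega>, u) i. (X i \<omega>, u i))
      = Pi\<^sub>M UNIV (\<lambda>_. E \<Otimes>\<^sub>M R)"
proof -
  interpret P: prob_space P by fact
  interpret R: prob_space R by fact
  have Xm[measurable]: "X i \<in> measurable P E" for i
    using X by (auto simp: P.indep_vars_def)
  interpret E: prob_space E using P.prob_space_distr[OF Xm] E by metis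
  interpret ER: pair_prob_space E R ..
  interpret RR: product_prob_space "\<lambda>_. R" "UNIV :: 'i set" ..
  interpret EE: product_prob_space "\<lambda>_. E \<Otimes>\<^sub>M R" "UNIV :: 'i set" ..
  let ?U = "Pi\<^sub>M (UNIV :: 'i set) (\<lambda>_. R)" and ?N = "\<lambda>(\<omega>, u) i. (X i \<omega>, u i)"
    and ?C = "Pi\<^sub>M (UNIV :: 'i set) (\<lambda>_. E \<Otimes>\<^sub>M R)"
  interpret PU: pair_prob_space P ?U ..
  show m: "?N \<in> measurable (P \<Otimes>\<^sub>M ?U) ?C"
  proof (rule measurable_PiM_single')
    show "(\<lambda>x. ?N x i) \<in> measurable (P \<Otimes>\<^sub>M ?U) (E \<Otimes>\<^sub>M R)" for i
      by (simp add: case_prod_beta)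
    show "?N \<in> space (P \<Otimes>\<^sub>M ?U) \<rightarrow> (\<Pi>\<^sub>E i\<in>UNIV. space (E \<Otimes>\<^sub>M R))"
      using measurable_space[OF Xm] by (auto simp: space_pair_measure space_PiM PiE_iff)
  qed
  show "distr (P \<Otimes>\<^sub>M ?U) ?C ?N = ?C"
  proof (rule measure_eqI_PiM_infinite)
    show "finite_measure (distr (P \<Otimes>\<^sub>M ?U) ?C ?N)"
      by (rule PU.finite_measure_distr[OF m])
    fix F :: "'i \<Rightarrow> _" and J :: "'i set"
    assume J: "finite J" and F: "\<And>i. i \<in> J \<Longrightarrow> F i \<in> sets (E \<Otimes>\<^sub>M R)"
    let ?B = "prod_emb UNIV (\<lambda>_. E \<Otimes>\<^sub>M R) J (Pi\<^sub>E J F)"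
    have B: "?B \<in> sets ?C" using J F by (intro sets_PiM_I) auto
    have gm: "(\<lambda>x. emeasure R (Pair x -` F i)) \<in> borel_measurable E" if "i \<in> J" for i
      using R.measurable_emeasure_Pair[OF F[OF that]] .
    have "emeasure (distr (P \<Otimes>\<^sub>M ?U) ?C ?N) ?B = emeasure (P \<Otimes>\<^sub>M ?U) (?N -` ?B \<inter> space (P \<Otimes>\<^sub>M ?U))"
      by (rule emeasure_distr[OF m B])
    also have "\<dots> = (\<integral>\<^sup>+\<omega>. emeasure ?U (Pair \<omega> -` (?N -` ?B \<inter> space (P \<Otimes>\<^sub>M ?U))) \<partial>P)"
      by (rule RR.emeasure_pair_measure_alt[OF measurable_sets[OF m B]])
    also have "\<dots> = (\<integral>\<^sup>+\<omega>. (\<Prod>i\<in>J. emeasure R (Pair (X i \<omega>) -` F i)) \<partial>P)"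
    proof (rule nn_integral_cong)
      fix \<omega> assume w: "\<omega> \<in> space P"
      have eq: "Pair \<omega> -` (?N -` ?B \<inter> space (P \<Otimes>\<^sub>M ?U)) = {u \<in> space ?U. \<forall>i\<in>J. u i \<in> Pair (X i \<omega>) -` F i}"
        using w measurable_space[OF Xm w]
        by (auto simp: prod_emb_def space_pair_measure space_PiM PiE_iff)
      show "emeasure ?U (Pair \<omega> -` (?N -` ?B \<inter> space (P \<Otimes>\<^sub>M ?U)))
          = (\<Prod>i\<in>J. emeasure R (Pair (X i \<omega>) -` F i))"
        unfolding eq by (rule RR.emeasure_PiM_Collect) (use J F sets_Pair1 in auto)
    qed
    also have "\<dots> = (\<Prod>i\<in>J. \<integral>\<^sup>+\<omega>. emeasure R (Pair (X i \<omega>) -` F i) \<partial>P)"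
      by (rule P.indep_vars_nn_integral[OF J
            P.indep_vars_compose2[OF P.indep_vars_subset[OF X subset_UNIV] gm]]) simp_all
    also have "\<dots> = (\<Prod>i\<in>J. emeasure (E \<Otimes>\<^sub>M R) (F i))"
    proof (rule prod.cong[OF refl])
      fix i assume i: "i \<in> J"
      have "(\<integral>\<^sup>+\<omega>. emeasure R (Pair (X i \<omega>) -` F i) \<partial>P) = (\<integral>\<^sup>+x. emeasure R (Pair x -` F i) \<partial>distr P E (X i))"
        by (rule nn_integral_distr[OF Xm, symmetric]) (use gm[OF i] in simp)
      then show "(\<integral>\<^sup>+\<omega>. emeasure R (Pair (X i \<omega>) -` F i) \<partial>P) = emeasure (E \<Otimes>\<^sub>M R) (F i)"
        using R.emeasure_pair_measure_alt[OF F[OF i]] E by simp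
    qed
    also have "\<dots> = emeasure ?C ?B"
      using J F by (intro EE.emeasure_PiM_emb[symmetric]) auto
    finally show "emeasure (distr (P \<Otimes>\<^sub>M ?U) ?C ?N) ?B = emeasure ?C ?B" .
  qed auto
qed

section \<open>Executing the binomial operator by thresholds\<close>


definition unif :: "real measure" where
  "unif = uniform_measure lborel {0..1}"

text \<open>One realisation must serve every number of trials, hence infinitely many
  thresholds.\<close>

definition threshold_space :: "(nat \<Rightarrow> real) measure" where
  "threshold_space = Pi\<^sub>M UNIV (\<lambda>_. unif)"

text \<open>Taking \<open>frac\<close> sends the threshold 1, a null event, to 0. With thresholds in \<open>[0, 1)\<close> the
  pathwise statements below hold without exceptional set.\<close>

definition count_below :: "nat \<Rightarrow> real \<Rightarrow> (nat \<Rightarrow> real) \<Rightarrow> nat" where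
  "count_below n p z = card {i\<in>{..<n}. frac (z i) < p}"

lemma frac_measurable [measurable]: "(frac :: real \<Rightarrow> real) \<in> borel_measurable borel"
  unfolding frac_def by measurable

lemma sets_unif [measurable_cong, simp]: "sets unif = sets borel"
  by (simp add: unif_def)

lemma space_unif [simp]: "space unif = UNIV"
  by (simp add: unif_def)

lemma prob_space_unif: "prob_space unif"
  unfolding unif_def by (rule prob_space_uniform_measure) auto

lemma space_threshold_space [simp]: "space threshold_space = UNIV"
  by (simp add: threshold_space_def space_PiM PiE_UNIV_domain)

lemma prob_space_threshold_space: "prob_space threshold_space"
  unfolding threshold_space_def by (intro prob_space_PiM prob_space_unif)

lemma threshold_component_measurable [measurable]: "(\<lambda>z. z i) \<in> borel_measurable threshold_space"
proof -
  have "(\<lambda>z. z i) \<in> measurable threshold_space unif"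
    unfolding threshold_space_def by (rule measurable_component_singleton) simp
  then show ?thesis by (simp add: measurable_cong_sets[OF refl sets_unif])
qed

lemma emeasure_unif_frac_less:
  assumes "0 \<le> p" "p \<le> 1"
  shows "emeasure unif {x. frac x < p} = ennreal p"
proof (cases "p = 0")
  case True
  have "{x::real. frac x < 0} = {}" using frac_ge_0 by (auto simp: not_less)
  then show ?thesis using True by simp
next
  case False
  \<comment> \<open>\<open>frac\<close> sends the threshold 1 to 0, so it counts as below every
    positive \<open>p\<close>; this adds only a null set.\<close>
  have f: "frac x < p \<longleftrightarrow> x \<in> {0..<p} \<union> {1}" if "x \<in> {0..1}" for x :: real
  proof (cases "x = 1")
    case True
    then show ?thesis using False assms by simp
  next
    case False
    then have "frac x = x" using that by (simp add: frac_eq)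
    then show ?thesis using False that by auto
  qed
  have "{0..1} \<inter> {x::real. frac x < p} = {0..1} \<inter> ({0..<p} \<union> {1})"
    using f by blast
  also have "\<dots> = {0..<p} \<union> {1}" using assms by auto
  finally have "{0..1} \<inter> {x::real. frac x < p} = {0..<p} \<union> {1}" .
  moreover have "emeasure lborel ({0..<p} \<union> {1}) = emeasure lborel {0..<p}"
    by (rule emeasure_Un_null_set) (auto intro: null_setsI)
  ultimately show ?thesis
    using assms by (simp add: unif_def divide_ennreal_def)
qed

text \<open>Since \<open>frac x\<close> lies in [0, 1), subtracting it leaves the ceiling one above
  the floor of \<open>\<alpha>\<close> exactly when it is smaller than the fractional part. The
  deterministic part and one Bernoulli trial thus merge into a single ceiling.\<close>

lemma nat_floor_add_indicator:
  assumes "0 \<le> \<alpha>"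
  shows "nat \<lceil>\<alpha> - frac x\<rceil> = nat \<lfloor>\<alpha>\<rfloor> + (if frac x < frac \<alpha> then 1 else 0)"
proof -
  have x: "0 \<le> frac x" "frac x < 1" "0 \<le> frac \<alpha>" "frac \<alpha> < 1"
    by (auto simp: frac_ge_0 frac_lt_1)
  have a: "\<alpha> = of_int \<lfloor>\<alpha>\<rfloor> + frac \<alpha>" by (simp add: frac_def)
  have "\<lceil>\<alpha> - frac x\<rceil> = \<lfloor>\<alpha>\<rfloor> + (if frac x < frac \<alpha> then 1 else 0)"
  proof (cases "frac x < frac \<alpha>")
    case True
    have "\<lceil>\<alpha> - frac x\<rceil> = \<lfloor>\<alpha>\<rfloor> + 1"
      unfolding ceiling_eq_iff of_int_add of_int_1 using x a True by linarith
    then show ?thesis using True by simp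
  next
    case False
    have "\<lceil>\<alpha> - frac x\<rceil> = \<lfloor>\<alpha>\<rfloor>"
      unfolding ceiling_eq_iff using x a False by linarith
    then show ?thesis using False by simp
  qed
  moreover have "0 \<le> \<lfloor>\<alpha>\<rfloor>" using assms by simp
  ultimately show ?thesis by (simp add: nat_add_distrib)
qed

text \<open>In this form monotonicity and left-continuity in \<open>\<alpha>\<close> are those of the ceiling.\<close>

lemma binomial_mult_count_below:
  assumes "0 \<le> \<alpha>"
  shows "binomial_mult count_below \<alpha> n z = (\<Sum>i<n. nat \<lceil>\<alpha> - frac (z i)\<rceil>)"
proof -
  have "(\<Sum>i<n. nat \<lceil>\<alpha> - frac (z i)\<rceil>)
      = n * nat \<lfloor>\<alpha>\<rfloor> + (\<Sum>i<n. if frac (z i) < frac \<alpha> then 1 else 0)"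
    by (simp only: nat_floor_add_indicator[OF assms] sum.distrib) simp
  also have "(\<Sum>i<n. if frac (z i) < frac \<alpha> then 1 else 0) = count_below n (frac \<alpha>) z"
    by (simp add: count_below_def sum.If_cases Int_def)
  finally show ?thesis by (simp add: binomial_mult_def frac_def)
qed

lemma binomial_mult_count_below_mono:
  assumes "0 \<le> \<alpha>" "\<alpha> \<le> \<beta>"
  shows "binomial_mult count_below \<alpha> n z \<le> binomial_mult count_below \<beta> n z"
  using assms by (simp add: binomial_mult_count_below) (intro sum_mono nat_mono ceiling_mono, simp)

text \<open>The ceiling is constant on intervals open to the left and closed to the right. A
  sequence approaching \<open>\<beta>\<close> from below eventually stays in the interval of
  \<open>\<beta>\<close>, so integer values give equality rather than mere convergence; only
  \<open>n\<close> thresholds are involved.\<close>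

lemma binomial_mult_count_below_left_continuous:
  assumes \<alpha>: "\<And>k. 0 \<le> \<alpha> k" "\<And>k. \<alpha> k \<le> \<beta>" and lim: "\<alpha> \<longlonglongrightarrow> \<beta>"
  shows "\<forall>\<^sub>F k in sequentially. binomial_mult count_below (\<alpha> k) n z = binomial_mult count_below \<beta> n z"
proof -
  have \<beta>: "0 \<le> \<beta>" using \<alpha> order_trans by blast
  have "\<forall>\<^sub>F k in sequentially. \<lceil>\<alpha> k - x\<rceil> = \<lceil>\<beta> - x\<rceil>" for x
  proof -
    have "of_int \<lceil>\<beta> - x\<rceil> - 1 < \<beta> - x" by linarith
    then have "of_int \<lceil>\<beta> - x\<rceil> - 1 + x < \<beta>" by simp
    from order_tendstoD(1)[OF lim this] show ?thesis
    proof eventually_elim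
      case (elim k)
      then show ?case using \<alpha>(2)[of k] by linarith
    qed
  qed
  then have "\<forall>\<^sub>F k in sequentially. \<forall>i\<in>{..<n}. \<lceil>\<alpha> k - frac (z i)\<rceil> = \<lceil>\<beta> - frac (z i)\<rceil>"
    by (intro eventually_ball_finite) auto
  then show ?thesis
    by eventually_elim (simp add: binomial_mult_count_below \<alpha> \<beta>)
qed

lemma count_below_measurable:
  "(\<lambda>(n, p, z). count_below n p z)
    \<in> measurable (count_space UNIV \<Otimes>\<^sub>M borel \<Otimes>\<^sub>M threshold_space) (count_space UNIV)"
proof (rule measurable_pair_measure_countable1)
  fix n
  have [measurable]: "(\<lambda>y. snd y i) \<in> borel_measurable (borel \<Otimes>\<^sub>M threshold_space)" for i
    by (rule measurable_compose[OF measurable_snd threshold_component_measurable])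
  have "(\<lambda>y. case (n, y) of (n, p, z) \<Rightarrow> count_below n p z)
      = (\<lambda>y. \<Sum>i<n. if frac (snd y i) < fst y then 1 else 0)"
    by (simp add: count_below_def sum.If_cases Int_def case_prod_beta)
  also have "\<dots> \<in> measurable (borel \<Otimes>\<^sub>M threshold_space) (count_space UNIV)"
    by measurable
  finally show "(\<lambda>y. case (n, y) of (n, p, z) \<Rightarrow> count_below n p z)
      \<in> measurable (borel \<Otimes>\<^sub>M threshold_space) (count_space UNIV)" .
qed simp

lemma count_below_measurable' [measurable]:
  assumes [measurable]: "n \<in> measurable N (count_space UNIV)" "p \<in> borel_measurable N"
    "z \<in> measurable N threshold_space"
  shows "(\<lambda>x. count_below (n x) (p x) (z x)) \<in> measurable N (count_space UNIV)"
  using measurable_compose[OF _ count_below_measurable, of "\<lambda>x. (n x, p x, z x)" N] by simp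

lemma binomial_mult_measurable [measurable]:
  assumes [measurable]: "n \<in> measurable N (count_space UNIV)" "\<alpha> \<in> borel_measurable N"
    "z \<in> measurable N threshold_space"
  shows "(\<lambda>x. binomial_mult count_below (\<alpha> x) (n x) (z x)) \<in> measurable N (count_space UNIV)"
  unfolding binomial_mult_def by measurable

text \<open>The event of \<open>k\<close> successes is split according to the set \<open>A\<close>
  of successful trials. The resulting events \<open>ev A\<close> are disjoint cylinders of equal
  probability, and there are \<open>n choose k\<close> of them.\<close>

lemma distr_count_below:
  assumes p: "0 \<le> p" "p \<le> 1"
  shows "distr threshold_space (count_space UNIV) (count_below n p) = measure_pmf (binomial_pmf n p)"
proof (rule measure_eqI_countable[of _ UNIV])
  interpret U: prob_space unif by (rule prob_space_unif)
  interpret T: product_prob_space "\<lambda>_. unif" "UNIV :: nat set" ..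
  fix k
  define L where "L = {x :: real. frac x < p}"
  have L: "L \<in> sets unif" unfolding L_def by simp
  have mL: "measure unif L = p"
    using emeasure_unif_frac_less[OF p] p by (simp add: L_def measure_def)
  have mL': "measure unif (UNIV - L) = 1 - p"
    using U.prob_compl[OF L] mL by simp
  define H where "H A i = (if i \<in> A then L else UNIV - L)" for A and i :: nat
  define ev where "ev A = {z \<in> space threshold_space. \<forall>i\<in>{..<n}. z i \<in> H A i}" for A
  define \<A> where "\<A> = {A. A \<subseteq> {..<n} \<and> card A = k}"
  have fin: "finite \<A>" unfolding \<A>_def by (rule finite_subset[of _ "Pow {..<n}"]) auto
  have ev_iff: "z \<in> ev A \<longleftrightarrow> {i\<in>{..<n}. frac (z i) < p} = A" if "A \<subseteq> {..<n}" for z A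
  proof -
    have "z \<in> ev A \<longleftrightarrow> (\<forall>i<n. frac (z i) < p \<longleftrightarrow> i \<in> A)"
      by (auto simp: ev_def H_def L_def)
    also have "\<dots> \<longleftrightarrow> {i\<in>{..<n}. frac (z i) < p} = A"
      using that by blast
    finally show ?thesis .
  qed
  have evs: "ev A = prod_emb UNIV (\<lambda>_. unif) {..<n} (\<Pi>\<^sub>E i\<in>{..<n}. H A i)" for A
    by (rule set_eqI) (simp add: ev_def prod_emb_iff PiE_iff)
  have Hs: "H A i \<in> sets borel" for A i using L by (auto simp: H_def)
  have evm: "ev A \<in> sets threshold_space" for A
    unfolding evs threshold_space_def using Hs by (intro sets_PiM_I) auto
  have mev: "measure threshold_space (ev A) = p ^ k * (1 - p) ^ (n - k)" if "A \<in> \<A>" for A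
  proof -
    have A: "A \<subseteq> {..<n}" "card A = k" "finite A" using that finite_subset[of A "{..<n}"] by (auto simp: \<A>_def)
    have "measure threshold_space (ev A) = (\<Prod>i<n. measure unif (H A i))"
      unfolding evs threshold_space_def by (rule T.measure_PiM_emb) (auto simp: Hs)
    also have "\<dots> = (\<Prod>i<n. if i \<in> A then p else 1 - p)"
      by (intro prod.cong) (auto simp: H_def mL mL')
    also have "\<dots> = p ^ card ({..<n} \<inter> A) * (1 - p) ^ card ({..<n} - A)"
      by (simp add: prod.If_cases Diff_eq Int_def)
    also have "{..<n} \<inter> A = A" using A by auto
    also have "card ({..<n} - A) = n - k" using A by (simp add: card_Diff_subset)
    finally show ?thesis using A by simp
  qed
  have m: "count_below n p \<in> measurable threshold_space (count_space UNIV)"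
    by measurable
  have evA: "ev ` \<A> \<subseteq> sets threshold_space" using evm by blast
  have disj: "disjoint_family_on ev \<A>"
    unfolding disjoint_family_on_def
  proof (intro ballI impI)
    fix A A' assume "A \<in> \<A>" "A' \<in> \<A>" "A \<noteq> A'"
    then show "ev A \<inter> ev A' = {}"
      using ev_iff[of A] ev_iff[of A'] unfolding \<A>_def by blast
  qed
  have "count_below n p -` {k} \<inter> space threshold_space = (\<Union>A\<in>\<A>. ev A)"
  proof (rule set_eqI)
    fix z
    have "z \<in> (\<Union>A\<in>\<A>. ev A) \<longleftrightarrow> {i\<in>{..<n}. frac (z i) < p} \<in> \<A>"
      using ev_iff by (auto simp: \<A>_def)
    then show "z \<in> count_below n p -` {k} \<inter> space threshold_space \<longleftrightarrow> z \<in> (\<Union>A\<in>\<A>. ev A)"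
      by (auto simp: \<A>_def count_below_def)
  qed
  moreover have "measure threshold_space (\<Union>A\<in>\<A>. ev A) = (\<Sum>A\<in>\<A>. measure threshold_space (ev A))"
    by (rule finite_measure.finite_measure_finite_Union[OF prob_space.finite_measure[OF prob_space_threshold_space] fin evA disj])
  moreover have "(\<Sum>A\<in>\<A>. measure threshold_space (ev A)) = real (n choose k) * (p ^ k * (1 - p) ^ (n - k))"
    using n_subsets[of "{..<n}" k] by (simp add: mev \<A>_def)
  ultimately have "measure threshold_space (count_below n p -` {k} \<inter> space threshold_space)
      = pmf (binomial_pmf n p) k"
    using p by (simp add: pmf_binomial)
  then show "emeasure (distr threshold_space (count_space UNIV) (count_below n p)) {k}
      = emeasure (measure_pmf (binomial_pmf n p)) {k}"
    using finite_measure.emeasure_eq_measure[OF prob_space.finite_measure[OF prob_space_threshold_space]]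
    by (simp add: emeasure_distr[OF m] emeasure_pmf_single)
qed auto

text \<open>Randomized rounding is unbiased: the floor plus a Bernoulli trial with the fractional
  part as success probability.\<close>

lemma nn_integral_unif_ceiling:
  assumes "0 \<le> \<alpha>"
  shows "(\<integral>\<^sup>+x. of_nat (nat \<lceil>\<alpha> - frac x\<rceil>) \<partial>unif) = ennreal \<alpha>"
proof -
  interpret U: prob_space unif by (rule prob_space_unif)
  have L: "{x. frac x < frac \<alpha>} \<in> sets unif" by simp
  have "(\<integral>\<^sup>+x. of_nat (nat \<lceil>\<alpha> - frac x\<rceil>) \<partial>unif)
      = (\<integral>\<^sup>+x. of_nat (nat \<lfloor>\<alpha>\<rfloor>) + indicator {x. frac x < frac \<alpha>} x \<partial>unif)"
    by (intro nn_integral_cong) (simp add: nat_floor_add_indicator[OF assms])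
  also have "\<dots> = of_nat (nat \<lfloor>\<alpha>\<rfloor>) + emeasure unif {x. frac x < frac \<alpha>}"
    using U.emeasure_space_1 L by (subst nn_integral_add) (simp_all add: borel_measurable_indicator)
  also have "\<dots> = ennreal (of_int \<lfloor>\<alpha>\<rfloor>) + ennreal (frac \<alpha>)"
    using assms by (simp add: emeasure_unif_frac_less frac_ge_0 less_imp_le[OF frac_lt_1]
        ennreal_of_nat_eq_real_of_nat)
  also have "\<dots> = ennreal \<alpha>"
    using assms by (simp add: frac_def ennreal_plus[symmetric] del: ennreal_plus)
  finally show ?thesis .
qed

text \<open>The number of summands is independent of the thresholds and each summand has mean
  \<open>\<alpha>\<close>. That the mean is linear in \<open>\<alpha>\<close> makes the recursion
  for the expectations affine.\<close>

lemma nn_integral_binomial_mult: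
  assumes "0 \<le> \<alpha>" and E: "sets E = UNIV"
  shows "(\<integral>\<^sup>+e. of_nat (binomial_mult count_below \<alpha> (fst e) (snd e)) \<partial>(E \<Otimes>\<^sub>M threshold_space))
    = (\<integral>\<^sup>+n. of_nat n \<partial>E) * ennreal \<alpha>"
proof -
  interpret T: prob_space threshold_space by (rule prob_space_threshold_space)
  interpret T': product_prob_space "\<lambda>_. unif" "UNIV :: nat set"
    unfolding product_prob_space_def product_prob_space_axioms_def product_sigma_finite_def
    using prob_space_unif prob_space_imp_sigma_finite by blast
  have [measurable_cong]: "sets E = sets (count_space UNIV)" using E by simp
  have "(\<integral>\<^sup>+e. of_nat (binomial_mult count_below \<alpha> (fst e) (snd e)) \<partial>(E \<Otimes>\<^sub>M threshold_space))
      = (\<integral>\<^sup>+n. (\<integral>\<^sup>+z. of_nat (binomial_mult count_below \<alpha> n z) \<partial>threshold_space) \<partial>E)"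
    by (subst T.nn_integral_fst[symmetric]) auto
  also have "\<dots> = (\<integral>\<^sup>+n. of_nat n * ennreal \<alpha> \<partial>E)"
  proof (intro nn_integral_cong)
    fix n
    have "(\<integral>\<^sup>+z. of_nat (binomial_mult count_below \<alpha> n z) \<partial>threshold_space)
        = (\<integral>\<^sup>+z. (\<Sum>i<n. of_nat (nat \<lceil>\<alpha> - frac (z i)\<rceil>)) \<partial>threshold_space)"
      by (simp add: binomial_mult_count_below[OF assms(1)])
    also have "\<dots> = (\<Sum>i<n. (\<integral>\<^sup>+z. of_nat (nat \<lceil>\<alpha> - frac (z i)\<rceil>) \<partial>threshold_space))"
      by (rule nn_integral_sum) measurable
    also have "\<dots> = (\<Sum>i<n. ennreal \<alpha>)"
    proof (rule sum.cong[OF refl])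
      fix i
      have "(\<integral>\<^sup>+z. of_nat (nat \<lceil>\<alpha> - frac (z i)\<rceil>) \<partial>threshold_space)
          = (\<integral>\<^sup>+x. of_nat (nat \<lceil>\<alpha> - frac x\<rceil>) \<partial>distr threshold_space unif (\<lambda>z. z i))"
      proof (rule nn_integral_distr[symmetric])
        show "(\<lambda>z. z i) \<in> measurable threshold_space unif"
          unfolding threshold_space_def by (rule measurable_component_singleton) simp
        show "(\<lambda>x. of_nat (nat \<lceil>\<alpha> - frac x\<rceil>) :: ennreal) \<in> borel_measurable (distr threshold_space unif (\<lambda>z. z i))"
          unfolding measurable_distr_eq1 measurable_cong_sets[OF sets_unif refl] by measurable
      qed
      also have "distr threshold_space unif (\<lambda>z. z i) = unif"
        unfolding threshold_space_def using T'.PiM_component[of i] by simp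
      finally show "(\<integral>\<^sup>+z. of_nat (nat \<lceil>\<alpha> - frac (z i)\<rceil>) \<partial>threshold_space) = ennreal \<alpha>"
        using nn_integral_unif_ceiling[OF assms(1)] by simp
    qed
    finally show "(\<integral>\<^sup>+z. of_nat (binomial_mult count_below \<alpha> n z) \<partial>threshold_space) = of_nat n * ennreal \<alpha>"
      by simp
  qed
  also have "\<dots> = (\<integral>\<^sup>+n. of_nat n \<partial>E) * ennreal \<alpha>"
    by (rule nn_integral_multc) simp
  finally show ?thesis .
qed

section \<open>Picard iteration along a noise path\<close>


type_synonym noise_path = "int \<Rightarrow> nat \<times> (nat \<Rightarrow> real)"

locale count_mem =
  fixes p q :: nat and a b :: "nat \<Rightarrow> real"
  assumes a0: "a 0 > 0" and a_nonneg: "\<And>i. i \<in> {1..p} \<Longrightarrow> a i \<ge> 0"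
    and b_nonneg: "\<And>j. j \<in> {1..q} \<Longrightarrow> b j \<ge> 0"
    and contraction: "(\<Sum>i=1..p. a i) + (\<Sum>j=1..q. b j) < 1"
begin

definition rate :: real where
  "rate = (\<Sum>i=1..p. a i) + (\<Sum>j=1..q. b j)"

definition observe :: "real \<Rightarrow> int \<Rightarrow> noise_path \<Rightarrow> nat" where
  "observe \<alpha> t \<nu> = binomial_mult count_below \<alpha> (fst (\<nu> t)) (snd (\<nu> t))"

text \<open>Only the means are iterated; a count is recovered from its mean by
  \<open>observe\<close>. An iterate at time \<open>t\<close> therefore looks at noise strictly
  before \<open>t\<close>.\<close>

primrec mean_iter :: "nat \<Rightarrow> int \<Rightarrow> noise_path \<Rightarrow> real" where
  "mean_iter 0 t \<nu> = 0"
| "mean_iter (Suc n) t \<nu> = a 0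
    + (\<Sum>i=1..p. a i * real (observe (mean_iter n (t - int i) \<nu>) (t - int i) \<nu>))
    + (\<Sum>j=1..q. b j * mean_iter n (t - int j) \<nu>)"

text \<open>The value is 0 where the iterates are unbounded, a null set; this keeps \<open>mean\<close> nonnegative everywhere.\<close>

definition mean :: "int \<Rightarrow> noise_path \<Rightarrow> real" where
  "mean t \<nu> = enn2real (SUP n. ennreal (mean_iter n t \<nu>))"

definition count :: "int \<Rightarrow> noise_path \<Rightarrow> nat" where
  "count t \<nu> = observe (mean t \<nu>) t \<nu>"

text \<open>The distance by which one more iteration can extend the memory.\<close>

definition lag :: nat where
  "lag = max p q"

lemma rate: "0 \<le> rate" "rate < 1"
  using contraction a_nonneg b_nonneg unfolding rate_def by (auto intro!: add_nonneg_nonneg sum_nonneg)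

lemma mean_iter_nonneg: "0 \<le> mean_iter n t \<nu>"
proof (induction n arbitrary: t)
  case (Suc n)
  then show ?case
    using a0 a_nonneg b_nonneg by (auto intro!: add_nonneg_nonneg sum_nonneg mult_nonneg_nonneg)
qed simp

lemma observe_mono: "0 \<le> \<alpha> \<Longrightarrow> \<alpha> \<le> \<beta> \<Longrightarrow> observe \<alpha> t \<nu> \<le> observe \<beta> t \<nu>"
  unfolding observe_def by (rule binomial_mult_count_below_mono)

text \<open>The start 0 lies below the first iterate, and the right-hand side of the recursion is
  monotone because the coefficients are nonnegative.\<close>

lemma incseq_mean_iter: "incseq (\<lambda>n. mean_iter n t \<nu>)"
proof (rule incseq_SucI)
  show "mean_iter n t \<nu> \<le> mean_iter (Suc n) t \<nu>" for n
  proof (induction n arbitrary: t)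
    case 0
    show ?case using mean_iter_nonneg[of "Suc 0" t \<nu>] by simp
  next
    case (Suc n)
    have "(\<Sum>i=1..p. a i * real (observe (mean_iter n (t - int i) \<nu>) (t - int i) \<nu>))
       \<le> (\<Sum>i=1..p. a i * real (observe (mean_iter (Suc n) (t - int i) \<nu>) (t - int i) \<nu>))"
      by (intro sum_mono mult_left_mono of_nat_mono observe_mono mean_iter_nonneg Suc.IH a_nonneg)
    moreover have "(\<Sum>j=1..q. b j * mean_iter n (t - int j) \<nu>) \<le> (\<Sum>j=1..q. b j * mean_iter (Suc n) (t - int j) \<nu>)"
      by (intro sum_mono mult_left_mono Suc.IH b_nonneg)
    ultimately show ?case
      unfolding mean_iter.simps(2)[of "Suc n"] mean_iter.simps(2)[of n t] by linarith
  qed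
qed

lemma observe_cong: "\<nu> t = \<nu>' t \<Longrightarrow> observe \<alpha> t \<nu> = observe \<alpha> t \<nu>'"
  by (simp add: observe_def)

text \<open>The finite window of the \<open>n\<close>-th iterate gives exact independence of the
  remote past; that it ends strictly before \<open>t\<close> gives independence of the noise at
  \<open>t\<close>.\<close>

lemma mean_iter_cong:
  "(\<And>s. t - int (n * lag) \<le> s \<Longrightarrow> s < t \<Longrightarrow> \<nu> s = \<nu>' s) \<Longrightarrow> mean_iter n t \<nu> = mean_iter n t \<nu>'"
proof (induction n arbitrary: t)
  case (Suc n)
  have IH: "mean_iter n (t - int i) \<nu> = mean_iter n (t - int i) \<nu>'" if "i \<in> {1..p} \<union> {1..q}" for i
    by (rule Suc.IH) (use that in \<open>auto intro!: Suc.prems simp: lag_def\<close>)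
  have "\<nu> (t - int i) = \<nu>' (t - int i)" if "i \<in> {1..p}" for i
  proof (rule Suc.prems)
    have "i \<le> lag" using that by (auto simp: lag_def)
    then have "i \<le> Suc n * lag" by (simp add: trans_le_add1)
    then show "t - int (Suc n * lag) \<le> t - int i" by linarith
  qed (use that in simp)
  then have O: "observe \<alpha> (t - int i) \<nu> = observe \<alpha> (t - int i) \<nu>'" if "i \<in> {1..p}" for i \<alpha>
    using that by (intro observe_cong) auto
  show ?case
    unfolding mean_iter.simps
    by (intro arg_cong2[of _ _ _ _ "(+)"] sum.cong refl) (simp_all add: IH O)
qed simp

lemma mean_cong: "(\<And>s. s < t \<Longrightarrow> \<nu> s = \<nu>' s) \<Longrightarrow> mean t \<nu> = mean t \<nu>'"
  unfolding mean_def by (subst mean_iter_cong[of t _ \<nu> \<nu>']) auto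

lemma count_cong: "(\<And>s. s \<le> t \<Longrightarrow> \<nu> s = \<nu>' s) \<Longrightarrow> count t \<nu> = count t \<nu>'"
  unfolding count_def using mean_cong[of t \<nu> \<nu>'] observe_cong[of \<nu> t \<nu>'] by simp

lemma observe_shift: "observe \<alpha> (t + h) \<nu> = observe \<alpha> t (\<lambda>s. \<nu> (s + h))"
  by (simp add: observe_def)

lemma mean_iter_shift: "mean_iter n (t + h) \<nu> = mean_iter n t (\<lambda>s. \<nu> (s + h))"
proof (induction n arbitrary: t)
  case (Suc n)
  have e: "t + h - int i = (t - int i) + h" for i by simp
  show ?case unfolding mean_iter.simps e Suc observe_shift ..
qed simp

lemma mean_shift: "mean (t + h) \<nu> = mean t (\<lambda>s. \<nu> (s + h))"
  by (simp add: mean_def mean_iter_shift)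

lemma count_shift: "count (t + h) \<nu> = count t (\<lambda>s. \<nu> (s + h))"
  by (simp add: count_def mean_shift observe_shift)

lemma mean_nonneg: "0 \<le> mean t \<nu>"
  by (simp add: mean_def)

lemma mean_iter_tendsto:
  assumes "(SUP n. ennreal (mean_iter n t \<nu>)) \<noteq> \<infinity>"
  shows "(\<lambda>n. mean_iter n t \<nu>) \<longlonglongrightarrow> mean t \<nu>" and "mean_iter n t \<nu> \<le> mean t \<nu>"
proof -
  have e: "(SUP n. ennreal (mean_iter n t \<nu>)) = ennreal (mean t \<nu>)"
    unfolding mean_def
    by (rule ennreal_enn2real[symmetric]) (use assms in \<open>simp only: infinity_ennreal_def less_top[symmetric] not_False_eq_True\<close>)
  have "incseq (\<lambda>n. ennreal (mean_iter n t \<nu>))"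
    using incseq_mean_iter[of t \<nu>] by (auto simp: incseq_def intro!: ennreal_leI)
  then have "(\<lambda>n. ennreal (mean_iter n t \<nu>)) \<longlonglongrightarrow> ennreal (mean t \<nu>)"
    unfolding e[symmetric] by (rule LIMSEQ_SUP)
  then show l: "(\<lambda>n. mean_iter n t \<nu>) \<longlonglongrightarrow> mean t \<nu>"
    by (subst (asm) tendsto_ennreal_iff) (auto simp: mean_nonneg mean_iter_nonneg)
  show "mean_iter n t \<nu> \<le> mean t \<nu>"
    by (rule incseq_le[OF incseq_mean_iter l])
qed

text \<open>Here left-continuity enters: the iterates approach their limit from below, so the counts
  attain theirs after finitely many steps.\<close>

lemma observe_tendsto:
  assumes "(SUP n. ennreal (mean_iter n t \<nu>)) \<noteq> \<infinity>"
  shows "(\<lambda>n. real (observe (mean_iter n t \<nu>) t \<nu>)) \<longlonglongrightarrow> real (count t \<nu>)"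
proof (rule tendsto_eventually)
  have "\<forall>\<^sub>F n in sequentially. observe (mean_iter n t \<nu>) t \<nu> = count t \<nu>"
    unfolding observe_def count_def
    by (intro binomial_mult_count_below_left_continuous mean_iter_nonneg mean_iter_tendsto assms)
  then show "\<forall>\<^sub>F n in sequentially. real (observe (mean_iter n t \<nu>) t \<nu>) = real (count t \<nu>)"
    by eventually_elim simp
qed

text \<open>Both sides are limits of \<open>mean_iter (Suc n) t \<nu>\<close>. Boundedness is
  assumed at all times because the right-hand side visits earlier ones.\<close>

lemma mean_fixpoint:
  assumes "\<And>t. (SUP n. ennreal (mean_iter n t \<nu>)) \<noteq> \<infinity>"
  shows "mean t \<nu> = a 0 + (\<Sum>i=1..p. a i * real (count (t - int i) \<nu>)) + (\<Sum>j=1..q. b j * mean (t - int j) \<nu>)"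
proof (rule LIMSEQ_unique)
  show "(\<lambda>n. mean_iter (Suc n) t \<nu>) \<longlonglongrightarrow> mean t \<nu>"
    by (rule LIMSEQ_Suc[OF mean_iter_tendsto(1)[OF assms]])
  show "(\<lambda>n. mean_iter (Suc n) t \<nu>) \<longlonglongrightarrow>
      a 0 + (\<Sum>i=1..p. a i * real (count (t - int i) \<nu>)) + (\<Sum>j=1..q. b j * mean (t - int j) \<nu>)"
    unfolding mean_iter.simps
    by (intro tendsto_add tendsto_const tendsto_sum tendsto_mult observe_tendsto mean_iter_tendsto(1) assms)
qed

lemma mean_pos:
  assumes "(SUP n. ennreal (mean_iter n t \<nu>)) \<noteq> \<infinity>"
  shows "0 < mean t \<nu>"
proof -
  have "a 0 \<le> mean_iter (Suc 0) t \<nu>"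
    unfolding mean_iter.simps
    using a_nonneg by (auto intro!: sum_nonneg mult_nonneg_nonneg)
  then show ?thesis using a0 mean_iter_tendsto(2)[OF assms, of "Suc 0"] by linarith
qed

section \<open>Measurability with respect to the noise at a chosen set of times\<close>

context
  fixes D :: "(nat \<times> (nat \<Rightarrow> real)) measure"
  assumes sets_D: "sets D = sets (count_space UNIV \<Otimes>\<^sub>M threshold_space)"
begin

lemma observe_measurable:
  assumes "t \<in> A" and "m \<in> borel_measurable (Pi\<^sub>M A (\<lambda>_. D))"
  shows "(\<lambda>\<nu>. observe (m \<nu>) t \<nu>) \<in> measurable (Pi\<^sub>M A (\<lambda>_. D)) (count_space UNIV)"
proof -
  have "(\<lambda>\<nu>. \<nu> t) \<in> measurable (Pi\<^sub>M A (\<lambda>_. D)) D"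
    by (rule measurable_component_singleton[OF assms(1)])
  then have "(\<lambda>\<nu>. \<nu> t) \<in> measurable (Pi\<^sub>M A (\<lambda>_. D)) (count_space UNIV \<Otimes>\<^sub>M threshold_space)"
    by (simp add: measurable_cong_sets[OF refl sets_D])
  note [measurable] = measurable_compose[OF this measurable_fst] measurable_compose[OF this measurable_snd] assms(2)
  show ?thesis unfolding observe_def by (rule binomial_mult_measurable) measurable
qed

text \<open>Any index set containing the window is allowed, so that the lemma serves both the whole
  noise path and sigma-fields generated by a part of it.\<close>

lemma mean_iter_measurable:
  "{t - int (n * lag)..<t} \<subseteq> A \<Longrightarrow> mean_iter n t \<in> borel_measurable (Pi\<^sub>M A (\<lambda>_. D))"
proof (induction n arbitrary: t)
  case 0
  show ?case by (simp add: mean_iter.simps(1)[abs_def])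
next
  case (Suc n)
  have sub: "{t - int i - int (n * lag)..<t - int i} \<subseteq> A" if "i \<in> {1..p} \<union> {1..q}" for i
  proof -
    have "i \<le> lag" using that by (auto simp: lag_def)
    then have "{t - int i - int (n * lag)..<t - int i} \<subseteq> {t - int (Suc n * lag)..<t}" by auto
    then show ?thesis using Suc.prems by blast
  qed
  have tA: "t - int i \<in> A" if "i \<in> {1..p}" for i
  proof -
    have "i \<le> lag" using that by (auto simp: lag_def)
    then have "i \<le> Suc n * lag" by (simp add: trans_le_add1)
    then have "t - int (Suc n * lag) \<le> t - int i" by linarith
    then have "t - int i \<in> {t - int (Suc n * lag)..<t}" using that by simp
    then show ?thesis using Suc.prems by blast
  qed
  have m: "mean_iter n (t - int i) \<in> borel_measurable (Pi\<^sub>M A (\<lambda>_. D))" if "i \<in> {1..p} \<union> {1..q}" for i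
    by (rule Suc.IH[OF sub[OF that]])
  have o: "(\<lambda>\<nu>. real (observe (mean_iter n (t - int i) \<nu>) (t - int i) \<nu>)) \<in> borel_measurable (Pi\<^sub>M A (\<lambda>_. D))"
    if "i \<in> {1..p}" for i
    using measurable_compose[OF observe_measurable[OF tA[OF that] m], of i "\<lambda>n. real n" borel] that by simp
  show ?case
    unfolding mean_iter.simps(2)[abs_def]
    by (intro borel_measurable_add borel_measurable_const borel_measurable_sum borel_measurable_times o m) auto
qed

lemma mean_measurable: "{..<t} \<subseteq> A \<Longrightarrow> mean t \<in> borel_measurable (Pi\<^sub>M A (\<lambda>_. D))"
proof -
  assume A: "{..<t} \<subseteq> A"
  have [measurable]: "mean_iter n t \<in> borel_measurable (Pi\<^sub>M A (\<lambda>_. D))" for n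
    by (rule mean_iter_measurable) (use A in auto)
  show ?thesis unfolding mean_def[abs_def] by measurable
qed

lemma count_measurable: "{..t} \<subseteq> A \<Longrightarrow> count t \<in> measurable (Pi\<^sub>M A (\<lambda>_. D)) (count_space UNIV)"
  unfolding count_def[abs_def] by (rule observe_measurable[OF _ mean_measurable]) auto

lemma observe_mean_iter_measurable:
  assumes "{t - int (n * lag)..t} \<subseteq> A"
  shows "(\<lambda>\<nu>. observe (mean_iter n t \<nu>) t \<nu>) \<in> measurable (Pi\<^sub>M A (\<lambda>_. D)) (count_space UNIV)"
  by (rule observe_measurable[OF _ mean_iter_measurable]) (use assms in auto)

end

section \<open>Expectations under i.i.d. noise of unit mean\<close>

context
  fixes E :: "nat measure"
  assumes E: "prob_space E" "sets E = UNIV" and mean_E: "(\<integral>\<^sup>+n. of_nat n \<partial>E) = 1"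
begin

private abbreviation (input) "\<D> \<equiv> E \<Otimes>\<^sub>M threshold_space"
private abbreviation (input) "\<C> \<equiv> Pi\<^sub>M (UNIV :: int set) (\<lambda>_. \<D>)"

lemma sets_noise: "sets \<D> = sets (count_space UNIV \<Otimes>\<^sub>M threshold_space)"
  by (rule sets_pair_measure_cong) (auto simp: E)

lemma prob_space_noise: "prob_space \<D>"
  by (rule prob_space_pair[OF E(1) prob_space_threshold_space])

lemma space_E: "space E = UNIV"
  using sets_eq_imp_space_eq[of E "count_space UNIV"] E by simp

interpretation D: prob_space \<D> by (rule prob_space_noise)
interpretation C: product_prob_space "\<lambda>_. \<D>" "UNIV :: int set" ..

text \<open>\<open>m\<close> depends on the noise before \<open>t\<close> only, as
  \<open>cong\<close> expresses, and is independent of the noise at \<open>t\<close>. Integrating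
  out the latter with \<open>m\<close> frozen gives back \<open>m\<close>, the operator being
  unbiased when the innovations have mean 1.\<close>

lemma nn_integral_observe:
  assumes m: "m \<in> borel_measurable (Pi\<^sub>M {..<t} (\<lambda>_. \<D>))" and nn: "\<And>\<nu>. 0 \<le> m \<nu>"
    and cong: "\<And>\<nu>. m (restrict \<nu> {..<t}) = m \<nu>"
  shows "(\<integral>\<^sup>+\<nu>. of_nat (observe (m \<nu>) t \<nu>) \<partial>\<C>) = (\<integral>\<^sup>+\<nu>. ennreal (m \<nu>) \<partial>\<C>)"
proof -
  let ?W = "Pi\<^sub>M {..<t} (\<lambda>_. \<D>)"
  let ?T = "Pi\<^sub>M {t} (\<lambda>_. \<D>)"
  let ?r = "\<lambda>\<nu>::noise_path. restrict \<nu> {..<t}" and ?s = "\<lambda>\<nu>::noise_path. restrict \<nu> {t}"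
  have r: "?r \<in> measurable \<C> ?W" by (rule measurable_restrict_subset) simp
  have ct: "(\<lambda>\<nu>. \<nu> t) \<in> measurable \<C> \<D>" by (rule measurable_component_singleton) simp
  have iv: "C.indep_vars (\<lambda>_. \<D>) (\<lambda>i \<nu>. \<nu> i) (UNIV :: int set)"
    by (subst C.indep_vars_iff_distr_eq_PiM') (auto simp: C.PiM_component restrict_def)
  have "C.indep_var ?W ?r ?T ?s"
    using C.indep_var_restrict[OF iv, of "{..<t}" "{t}"] by simp
  \<comment> \<open>Independence of the noise before \<open>t\<close> from that at \<open>t\<close>,
    as an identity of measures to which Fubini applies.\<close>
  then have J: "distr \<C> ?W ?r \<Otimes>\<^sub>M distr \<C> ?T ?s = distr \<C> (?W \<Otimes>\<^sub>M ?T) (\<lambda>\<nu>. (?r \<nu>, ?s \<nu>))"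
    by (simp add: C.indep_var_distribution_eq)
  have Dt: "distr \<C> \<D> (\<lambda>\<nu>. \<nu> t) = \<D>" using C.PiM_component[of t] by simp
  have s: "?s \<in> measurable \<C> ?T" by (rule measurable_restrict_subset) simp
  interpret T: prob_space "distr \<C> ?T ?s" by (rule C.prob_space_distr[OF s])
  define g :: "noise_path \<times> noise_path \<Rightarrow> ennreal" where
    "g y = of_nat (binomial_mult count_below (m (fst y)) (fst (snd y t)) (snd (snd y t)))" for y
  have g: "g \<in> borel_measurable (?W \<Otimes>\<^sub>M ?T)"
  proof -
    have "(\<lambda>u. u t) \<in> measurable ?T \<D>" by (rule measurable_component_singleton) simp
    from measurable_compose[OF measurable_snd this]
    have "(\<lambda>y. snd y t) \<in> measurable (?W \<Otimes>\<^sub>M ?T) (count_space UNIV \<Otimes>\<^sub>M threshold_space)"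
      by (simp add: measurable_cong_sets[OF refl sets_noise])
    note [measurable] = measurable_compose[OF this measurable_fst] measurable_compose[OF this measurable_snd]
      measurable_compose[OF measurable_fst m]
    have "(\<lambda>y. binomial_mult count_below (m (fst y)) (fst (snd y t)) (snd (snd y t)))
        \<in> measurable (?W \<Otimes>\<^sub>M ?T) (count_space UNIV)"
      by (rule binomial_mult_measurable) measurable
    from measurable_compose[OF this, of of_nat borel] show ?thesis unfolding g_def by simp
  qed
  have pr: "(\<lambda>\<nu>. (?r \<nu>, ?s \<nu>)) \<in> measurable \<C> (?W \<Otimes>\<^sub>M ?T)"
    using r s by (rule measurable_Pair)
  have inner: "(\<integral>\<^sup>+u. g (w, u) \<partial>distr \<C> ?T ?s) = ennreal (m w)" if w: "w \<in> space ?W" for w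
  proof -
    have gw: "(\<lambda>u. g (w, u)) \<in> borel_measurable ?T"
      using g w by simp
    have gD: "(\<lambda>e. of_nat (binomial_mult count_below (m w) (fst e) (snd e)) :: ennreal) \<in> borel_measurable \<D>"
    proof -
      have "(\<lambda>e. binomial_mult count_below (m w) (fst e) (snd e)) \<in> measurable \<D> (count_space UNIV)"
        unfolding measurable_cong_sets[OF sets_noise refl] by (rule binomial_mult_measurable) measurable
      from measurable_compose[OF this, of of_nat borel] show ?thesis by simp
    qed
    have "(\<integral>\<^sup>+u. g (w, u) \<partial>distr \<C> ?T ?s) = (\<integral>\<^sup>+\<nu>. g (w, ?s \<nu>) \<partial>\<C>)"
      by (rule nn_integral_distr[OF s]) (use gw in simp)
    also have "\<dots> = (\<integral>\<^sup>+\<nu>. of_nat (binomial_mult count_below (m w) (fst (\<nu> t)) (snd (\<nu> t))) \<partial>\<C>)"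
      by (simp add: g_def)
    also have "\<dots> = (\<integral>\<^sup>+e. of_nat (binomial_mult count_below (m w) (fst e) (snd e)) \<partial>distr \<C> \<D> (\<lambda>\<nu>. \<nu> t))"
      by (rule nn_integral_distr[OF ct, symmetric]) (use gD in simp)
    also have "\<dots> = ennreal (m w)"
      unfolding Dt nn_integral_binomial_mult[OF nn E(2)] mean_E by simp
    finally show ?thesis .
  qed
  have "(\<integral>\<^sup>+\<nu>. of_nat (observe (m \<nu>) t \<nu>) \<partial>\<C>) = (\<integral>\<^sup>+\<nu>. g (?r \<nu>, ?s \<nu>) \<partial>\<C>)"
    by (simp add: g_def observe_def cong)
  also have "\<dots> = (\<integral>\<^sup>+y. g y \<partial>distr \<C> (?W \<Otimes>\<^sub>M ?T) (\<lambda>\<nu>. (?r \<nu>, ?s \<nu>)))"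
    by (rule nn_integral_distr[symmetric, OF pr]) (simp add: g)
  also have "\<dots> = (\<integral>\<^sup>+y. g y \<partial>(distr \<C> ?W ?r \<Otimes>\<^sub>M distr \<C> ?T ?s))"
    using J by simp
  also have "\<dots> = (\<integral>\<^sup>+w. (\<integral>\<^sup>+u. g (w, u) \<partial>distr \<C> ?T ?s) \<partial>distr \<C> ?W ?r)"
  proof (rule T.nn_integral_fst[symmetric])
    have eq: "sets (distr \<C> ?W ?r \<Otimes>\<^sub>M distr \<C> ?T ?s) = sets (?W \<Otimes>\<^sub>M ?T)" by (rule sets_pair_measure_cong) auto
    show "g \<in> borel_measurable (distr \<C> ?W ?r \<Otimes>\<^sub>M distr \<C> ?T ?s)"
      unfolding measurable_cong_sets[OF eq refl] by (rule g)
  qed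
  also have "\<dots> = (\<integral>\<^sup>+w. ennreal (m w) \<partial>distr \<C> ?W ?r)"
    by (rule nn_integral_cong) (simp add: inner)
  also have "\<dots> = (\<integral>\<^sup>+\<nu>. ennreal (m (?r \<nu>)) \<partial>\<C>)"
    by (rule nn_integral_distr[OF r]) (use m in simp)
  finally show ?thesis by (simp add: cong)
qed

lemma mean_iter_measurable_C: "mean_iter n t \<in> borel_measurable \<C>"
  by (rule mean_iter_measurable[OF sets_noise]) simp

lemma observe_measurable_C: "(\<lambda>\<nu>. observe (mean_iter n t \<nu>) t \<nu>) \<in> measurable \<C> (count_space UNIV)"
  by (rule observe_mean_iter_measurable[OF sets_noise]) simp

lemma count_measurable_C: "count t \<in> measurable \<C> (count_space UNIV)"
  by (rule count_measurable[OF sets_noise]) simp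

lemma nn_integral_observe_mean_iter:
  "(\<integral>\<^sup>+\<nu>. of_nat (observe (mean_iter n t \<nu>) t \<nu>) \<partial>\<C>) = (\<integral>\<^sup>+\<nu>. ennreal (mean_iter n t \<nu>) \<partial>\<C>)"
  by (rule nn_integral_observe[OF mean_iter_measurable[OF sets_noise] mean_iter_nonneg mean_iter_cong]) auto

lemma nn_integral_count: "(\<integral>\<^sup>+\<nu>. of_nat (count t \<nu>) \<partial>\<C>) = (\<integral>\<^sup>+\<nu>. ennreal (mean t \<nu>) \<partial>\<C>)"
  unfolding count_def
  by (rule nn_integral_observe[OF mean_measurable[OF sets_noise] mean_nonneg mean_cong]) auto

text \<open>A geometric sum, the closed form of the affine recursion started at 0. It does not
  depend on \<open>t\<close>, so all lagged terms contribute the same value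
  \<open>x\<close>.\<close>

lemma nn_integral_mean_iter:
  "(\<integral>\<^sup>+\<nu>. ennreal (mean_iter n t \<nu>) \<partial>\<C>) = ennreal (a 0 * (1 - rate ^ n) / (1 - rate))"
proof (induction n arbitrary: t)
  case (Suc n)
  define x where "x = a 0 * (1 - rate ^ n) / (1 - rate)"
  have x: "0 \<le> x" unfolding x_def using a0 rate by (simp add: power_le_one)
  note [measurable] = mean_iter_measurable_C observe_measurable_C
  have o[measurable]: "(\<lambda>\<nu>. of_nat (observe (mean_iter n t \<nu>) t \<nu>) :: ennreal) \<in> borel_measurable \<C>" for t
    using measurable_compose[OF observe_measurable_C[of n t], of of_nat borel] by simp
  have "(\<integral>\<^sup>+\<nu>. ennreal (mean_iter (Suc n) t \<nu>) \<partial>\<C>) = (\<integral>\<^sup>+\<nu>. ennreal (a 0)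
      + (\<Sum>i=1..p. ennreal (a i) * of_nat (observe (mean_iter n (t - int i) \<nu>) (t - int i) \<nu>))
      + (\<Sum>j=1..q. ennreal (b j) * ennreal (mean_iter n (t - int j) \<nu>)) \<partial>\<C>)"
  proof (rule nn_integral_cong)
    fix \<nu>
    have s1: "ennreal (\<Sum>i=1..p. a i * real (observe (mean_iter n (t - int i) \<nu>) (t - int i) \<nu>))
        = (\<Sum>i=1..p. ennreal (a i) * of_nat (observe (mean_iter n (t - int i) \<nu>) (t - int i) \<nu>))"
      using a_nonneg by (subst sum_ennreal[symmetric])
        (auto intro!: sum.cong simp: ennreal_mult ennreal_of_nat_eq_real_of_nat)
    have s2: "ennreal (\<Sum>j=1..q. b j * mean_iter n (t - int j) \<nu>)
        = (\<Sum>j=1..q. ennreal (b j) * ennreal (mean_iter n (t - int j) \<nu>))"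
      using b_nonneg by (subst sum_ennreal[symmetric])
        (auto intro!: sum.cong simp: ennreal_mult mean_iter_nonneg)
    have n1: "0 \<le> (\<Sum>i=1..p. a i * real (observe (mean_iter n (t - int i) \<nu>) (t - int i) \<nu>))"
      using a_nonneg by (auto intro!: sum_nonneg)
    have n2: "0 \<le> (\<Sum>j=1..q. b j * mean_iter n (t - int j) \<nu>)"
      using b_nonneg by (auto intro!: sum_nonneg mult_nonneg_nonneg mean_iter_nonneg)
    show "ennreal (mean_iter (Suc n) t \<nu>) = ennreal (a 0)
      + (\<Sum>i=1..p. ennreal (a i) * of_nat (observe (mean_iter n (t - int i) \<nu>) (t - int i) \<nu>))
      + (\<Sum>j=1..q. ennreal (b j) * ennreal (mean_iter n (t - int j) \<nu>))"
      unfolding mean_iter.simps s1[symmetric] s2[symmetric] using a0 n1 n2 by simp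
  qed
  also have "\<dots> = ennreal (a 0)
      + (\<Sum>i=1..p. ennreal (a i) * (\<integral>\<^sup>+\<nu>. of_nat (observe (mean_iter n (t - int i) \<nu>) (t - int i) \<nu>) \<partial>\<C>))
      + (\<Sum>j=1..q. ennreal (b j) * (\<integral>\<^sup>+\<nu>. ennreal (mean_iter n (t - int j) \<nu>) \<partial>\<C>))"
    by (simp add: nn_integral_add nn_integral_sum nn_integral_cmult C.P.emeasure_space_1)
  also have "\<dots> = ennreal (a 0) + (\<Sum>i=1..p. ennreal (a i * x)) + (\<Sum>j=1..q. ennreal (b j * x))"
    unfolding nn_integral_observe_mean_iter Suc.IH x_def[symmetric]
    by (intro arg_cong2[of _ _ _ _ "(+)"] sum.cong refl) (simp_all add: ennreal_mult a_nonneg b_nonneg x)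
  also have "\<dots> = ennreal (a 0 + (\<Sum>i=1..p. a i * x) + (\<Sum>j=1..q. b j * x))"
  proof -
    have na: "0 \<le> a i * x" if "i \<in> {1..p}" for i using a_nonneg[OF that] x by simp
    have nb: "0 \<le> b j * x" if "j \<in> {1..q}" for j using b_nonneg[OF that] x by simp
    show ?thesis
      using a0 sum_nonneg[of "{1..p}" "\<lambda>i. a i * x", OF na] sum_nonneg[of "{1..q}" "\<lambda>j. b j * x", OF nb]
      by (simp only: sum_ennreal[OF na] sum_ennreal[OF nb] ennreal_plus add_nonneg_nonneg less_imp_le)
  qed
  also have "a 0 + (\<Sum>i=1..p. a i * x) + (\<Sum>j=1..q. b j * x) = a 0 + rate * x"
    by (simp only: rate_def sum_distrib_right distrib_right add.assoc)
  also have "\<dots> = a 0 * (1 - rate ^ Suc n) / (1 - rate)"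
    using rate by (simp add: x_def field_simps)
  finally show ?case .
qed simp

lemma nn_integral_SUP_mean_iter:
  "(\<integral>\<^sup>+\<nu>. (SUP n. ennreal (mean_iter n t \<nu>)) \<partial>\<C>) = ennreal (a 0 / (1 - rate))"
proof -
  have inc: "incseq (\<lambda>n \<nu>. ennreal (mean_iter n t \<nu>))"
    using incseq_mean_iter by (auto simp: incseq_def le_fun_def intro!: ennreal_leI)
  have "(\<integral>\<^sup>+\<nu>. (SUP n. ennreal (mean_iter n t \<nu>)) \<partial>\<C>) = (SUP n. \<integral>\<^sup>+\<nu>. ennreal (mean_iter n t \<nu>) \<partial>\<C>)"
    using mean_iter_measurable_C by (intro nn_integral_monotone_convergence_SUP inc) simp
  also have "\<dots> = ennreal (a 0 / (1 - rate))"
  proof (rule LIMSEQ_unique[OF LIMSEQ_SUP])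
    show "incseq (\<lambda>n. \<integral>\<^sup>+\<nu>. ennreal (mean_iter n t \<nu>) \<partial>\<C>)"
      using inc by (auto simp: incseq_def le_fun_def intro!: nn_integral_mono)
    have "(\<lambda>n. a 0 * (1 - rate ^ n) / (1 - rate)) \<longlonglongrightarrow> a 0 * (1 - 0) / (1 - rate)"
      using rate by (intro tendsto_intros LIMSEQ_realpow_zero) auto
    then show "(\<lambda>n. \<integral>\<^sup>+\<nu>. ennreal (mean_iter n t \<nu>) \<partial>\<C>) \<longlonglongrightarrow> ennreal (a 0 / (1 - rate))"
      unfolding nn_integral_mean_iter by (intro tendsto_ennrealI) simp
  qed
  finally show ?thesis .
qed

text \<open>A finite expectation forces finiteness almost everywhere, and the times are countable,
  so one null set serves all of them, as \<open>mean_fixpoint\<close> requires.\<close>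

lemma AE_mean_iter_bounded: "AE \<nu> in \<C>. \<forall>t. (SUP n. ennreal (mean_iter n t \<nu>)) \<noteq> \<infinity>"
  unfolding AE_all_countable
proof
  note [measurable] = mean_iter_measurable_C
  show "AE \<nu> in \<C>. (SUP n. ennreal (mean_iter n t \<nu>)) \<noteq> \<infinity>" for t
    by (rule nn_integral_PInf_AE) (auto simp: nn_integral_SUP_mean_iter)
qed

lemma nn_integral_mean: "(\<integral>\<^sup>+\<nu>. ennreal (mean t \<nu>) \<partial>\<C>) = ennreal (a 0 / (1 - rate))"
  unfolding nn_integral_SUP_mean_iter[of t, symmetric]
proof (rule nn_integral_cong_AE)
  show "AE \<nu> in \<C>. ennreal (mean t \<nu>) = (SUP n. ennreal (mean_iter n t \<nu>))"
    using AE_mean_iter_bounded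
  proof eventually_elim
    case (elim \<nu>)
    then show ?case
      unfolding mean_def by (intro ennreal_enn2real) (simp only: infinity_ennreal_def less_top[symmetric] not_False_eq_True)
  qed
qed

text \<open>Almost surely the approximating count lies below its limit, so the L1 distance is the
  difference of two known expectations, namely the tail of the geometric series.\<close>

lemma nn_integral_count_diff:
  "(\<integral>\<^sup>+\<nu>. ennreal \<bar>real (count t \<nu>) - real (observe (mean_iter n t \<nu>) t \<nu>)\<bar> \<partial>\<C>)
    = ennreal (a 0 * rate ^ n / (1 - rate))"
proof -
  let ?o = "\<lambda>\<nu>. observe (mean_iter n t \<nu>) t \<nu>"
  have [measurable]: "(\<lambda>\<nu>. real (?o \<nu>)) \<in> borel_measurable \<C>" "(\<lambda>\<nu>. real (count t \<nu>)) \<in> borel_measurable \<C>"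
    using measurable_compose[OF observe_measurable_C[of n t], of real borel]
      measurable_compose[OF count_measurable_C[of t], of real borel] by simp_all
  have le: "AE \<nu> in \<C>. ?o \<nu> \<le> count t \<nu>"
    using AE_mean_iter_bounded
    by eventually_elim (simp add: count_def observe_mono mean_iter_nonneg mean_iter_tendsto(2))
  have "ennreal (a 0 / (1 - rate)) = (\<integral>\<^sup>+\<nu>. of_nat (count t \<nu>) \<partial>\<C>)"
    by (simp add: nn_integral_count nn_integral_mean)
  also have "\<dots> = (\<integral>\<^sup>+\<nu>. ennreal (real (?o \<nu>)) + ennreal \<bar>real (count t \<nu>) - real (?o \<nu>)\<bar> \<partial>\<C>)"
  proof (rule nn_integral_cong_AE)
    show "AE \<nu> in \<C>. of_nat (count t \<nu>) = ennreal (real (?o \<nu>)) + ennreal \<bar>real (count t \<nu>) - real (?o \<nu>)\<bar>"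
      using le by eventually_elim (simp add: ennreal_of_nat_eq_real_of_nat flip: ennreal_plus)
  qed
  also have "\<dots> = (\<integral>\<^sup>+\<nu>. of_nat (?o \<nu>) \<partial>\<C>) + (\<integral>\<^sup>+\<nu>. ennreal \<bar>real (count t \<nu>) - real (?o \<nu>)\<bar> \<partial>\<C>)"
    by (subst nn_integral_add) (auto simp: ennreal_of_nat_eq_real_of_nat)
  also have "(\<integral>\<^sup>+\<nu>. of_nat (?o \<nu>) \<partial>\<C>) = ennreal (a 0 * (1 - rate ^ n) / (1 - rate))"
    by (simp only: nn_integral_observe_mean_iter nn_integral_mean_iter)
  finally have eq: "ennreal (a 0 / (1 - rate)) = ennreal (a 0 * (1 - rate ^ n) / (1 - rate))
      + (\<integral>\<^sup>+\<nu>. ennreal \<bar>real (count t \<nu>) - real (?o \<nu>)\<bar> \<partial>\<C>)" .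
  have "a 0 / (1 - rate) = a 0 * (1 - rate ^ n) / (1 - rate) + a 0 * rate ^ n / (1 - rate)"
    by (simp add: add_divide_distrib[symmetric] algebra_simps)
  then have "ennreal (a 0 / (1 - rate)) = ennreal (a 0 * (1 - rate ^ n) / (1 - rate)) + ennreal (a 0 * rate ^ n / (1 - rate))"
    using a0 rate by (simp add: power_le_one flip: ennreal_plus)
  \<comment> \<open>Cancellation in the extended reals is legitimate because the common summand is
    finite.\<close>
  from trans[OF eq[symmetric] this] show ?thesis
    unfolding ennreal_add_left_cancel by (simp only: infinity_ennreal_def ennreal_neq_top simp_thms)
qed

end

end

section \<open>The solution on a probability space\<close>


text \<open>Lists of counts are the countable code through which a vector of counts enters
  \<open>tau_le\<close>.\<close>

lemma measurable_map_upt: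
  fixes f :: "nat \<Rightarrow> 'a \<Rightarrow> 'x::countable"
  assumes "\<And>k. k < l \<Longrightarrow> f k \<in> measurable M (count_space UNIV)"
  shows "(\<lambda>\<omega>. map (\<lambda>k. f k \<omega>) [0..<l]) \<in> measurable M (count_space UNIV)"
proof -
  let ?g = "\<lambda>\<omega>. map (\<lambda>k. f k \<omega>) [0..<l]"
  have "?g -` {d} \<inter> space M \<in> sets M" for d
  proof (cases "length d = l")
    case True
    have "{\<omega> \<in> space M. \<forall>k\<in>{..<l}. f k \<omega> = d ! k} \<in> sets M"
    proof (rule sets.sets_Collect_finite_All)
      fix k assume "k \<in> {..<l}"
      then have "f k -` {d ! k} \<inter> space M \<in> sets M"
        by (intro measurable_sets[OF assms]) auto
      also have "f k -` {d ! k} \<inter> space M = {\<omega> \<in> space M. f k \<omega> = d ! k}" by auto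
      finally show "{\<omega> \<in> space M. f k \<omega> = d ! k} \<in> sets M" .
    qed simp
    also have "{\<omega> \<in> space M. \<forall>k\<in>{..<l}. f k \<omega> = d ! k} = ?g -` {d} \<inter> space M"
    proof -
      have "?g \<omega> = d \<longleftrightarrow> (\<forall>k\<in>{..<l}. f k \<omega> = d ! k)" for \<omega>
        by (subst list_eq_iff_nth_eq) (simp add: True Ball_def)
      then show ?thesis by blast
    qed
    finally show ?thesis .
  next
    case False
    then have "?g -` {d} \<inter> space M = {}" by auto
    then show ?thesis by simp
  qed
  then show ?thesis
    by (intro iffD2[OF measurable_count_space_eq2_countable]) auto
qed

lemma sets_generated_sigma_subset:
  assumes "space V = space P" and "\<And>i. i \<in> I \<Longrightarrow> Y i \<in> measurable V S"
  shows "sets (generated_sigma P S I Y) \<subseteq> sets V"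
proof -
  have "{Y i -` A \<inter> space P |A. A \<in> sets S} \<subseteq> sets V" if "i \<in> I" for i
    using measurable_sets[OF assms(2)[OF that]] assms(1) by auto
  then have "(\<Union>i\<in>I. {Y i -` A \<inter> space P |A. A \<in> sets S}) \<subseteq> sets V" by blast
  then have "sigma_sets (space P) (\<Union>i\<in>I. {Y i -` A \<inter> space P |A. A \<in> sets S}) \<subseteq> sets V"
    unfolding assms(1)[symmetric] by (rule sets.sigma_sets_subset)
  then show ?thesis
    unfolding generated_sigma_def by (subst sets_measure_of) auto
qed

lemma space_generated_sigma [simp]: "space (generated_sigma P S I Y) = space P"
  unfolding generated_sigma_def by (rule space_measure_of) auto

lemma (in prob_space) indep_set_mono:
  assumes "indep_set A B" "A' \<subseteq> A" "B' \<subseteq> B"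
  shows "indep_set A' B'"
  using assms indep_setD[OF assms(1)] indep_setD_ev1[OF assms(1)] indep_setD_ev2[OF assms(1)]
  by (intro indep_setI) blast+

text \<open>\<open>Q\<close> is abstract apart from a map \<open>N\<close> to noise paths with the
  product law. The given sequence can thus stay on its own space, while all computations are done
  under the product measure.\<close>

locale noise_driven = count_mem p q a b + Q: prob_space Q
  for p q :: nat and a b :: "nat \<Rightarrow> real" and Q :: "'v measure" +
  fixes E :: "nat measure" and N :: "'v \<Rightarrow> noise_path"
  assumes E: "prob_space E" "sets E = UNIV" "(\<integral>\<^sup>+n. of_nat n \<partial>E) = 1"
    and N: "N \<in> measurable Q (Pi\<^sub>M UNIV (\<lambda>_. E \<Otimes>\<^sub>M threshold_space))"
    and law: "distr Q (Pi\<^sub>M UNIV (\<lambda>_. E \<Otimes>\<^sub>M threshold_space)) N = Pi\<^sub>M UNIV (\<lambda>_. E \<Otimes>\<^sub>M threshold_space)"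
    and p: "p \<ge> 1"
begin

abbreviation (input) "D \<equiv> E \<Otimes>\<^sub>M threshold_space"
abbreviation (input) "C \<equiv> Pi\<^sub>M (UNIV :: int set) (\<lambda>_. D)"
abbreviation "X t \<omega> \<equiv> count t (N \<omega>)"
abbreviation "M t \<omega> \<equiv> mean t (N \<omega>)"

lemmas sets_noise' = sets_noise[OF E]
lemmas D_prob = prob_space_noise[OF E]

lemma noise_measurable: "(\<lambda>\<omega>. N \<omega> t) \<in> measurable Q D"
  by (rule measurable_compose[OF N measurable_component_singleton]) simp

lemma distr_noise: "distr Q D (\<lambda>\<omega>. N \<omega> t) = D"
proof -
  have "distr Q D (\<lambda>\<omega>. N \<omega> t) = distr (distr Q C N) D (\<lambda>\<nu>. \<nu> t)"
    by (subst distr_distr[OF _ N]) (auto simp: comp_def)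
  then show ?thesis
    unfolding law using distr_PiM_component[of UNIV "\<lambda>_. D" t] D_prob by simp
qed

lemma indep_noise: "Q.indep_vars (\<lambda>_. D) (\<lambda>t \<omega>. N \<omega> t) UNIV"
  by (subst Q.indep_vars_iff_distr_eq_PiM')
     (auto simp: noise_measurable distr_noise restrict_def law)

definition noise_sigma :: "int set \<Rightarrow> 'v measure" where
  "noise_sigma A = vimage_algebra (space Q) (\<lambda>\<omega>. restrict (N \<omega>) A) (Pi\<^sub>M A (\<lambda>_. D))"

lemma restrict_noise_measurable: "(\<lambda>\<omega>. restrict (N \<omega>) A) \<in> measurable Q (Pi\<^sub>M A (\<lambda>_. D))"
  by (rule measurable_compose[OF N measurable_restrict_subset]) simp

lemma noise_sigma_measurable: "(\<lambda>\<omega>. restrict (N \<omega>) A) \<in> measurable (noise_sigma A) (Pi\<^sub>M A (\<lambda>_. D))"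
  unfolding noise_sigma_def
  using measurable_space[OF restrict_noise_measurable] by (intro measurable_vimage_algebra1) auto

lemma space_noise_sigma [simp]: "space (noise_sigma A) = space Q"
  by (simp add: noise_sigma_def)

lemma sets_noise_sigma:
  "sets (noise_sigma A) = {(\<lambda>\<omega>. restrict (N \<omega>) A) -` S \<inter> space Q |S. S \<in> sets (Pi\<^sub>M A (\<lambda>_. D))}"
  unfolding noise_sigma_def
  using measurable_space[OF restrict_noise_measurable] by (intro sets_vimage_algebra2) auto

lemma sets_noise_sigma_subset: "sets (noise_sigma A) \<subseteq> sets Q"
  unfolding sets_noise_sigma using measurable_sets[OF restrict_noise_measurable] by auto

lemma indep_noise_sigma:
  assumes "A \<inter> B = {}"
  shows "Q.indep_set (sets (noise_sigma A)) (sets (noise_sigma B))"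
proof -
  have "Q.indep_var (Pi\<^sub>M A (\<lambda>_. D)) (\<lambda>\<omega>. restrict (N \<omega>) A) (Pi\<^sub>M B (\<lambda>_. D)) (\<lambda>\<omega>. restrict (N \<omega>) B)"
    using Q.indep_var_restrict[OF indep_noise assms] by simp
  then have "Q.indep_set
      (sigma_sets (space Q) {(\<lambda>\<omega>. restrict (N \<omega>) A) -` S \<inter> space Q |S. S \<in> sets (Pi\<^sub>M A (\<lambda>_. D))})
      (sigma_sets (space Q) {(\<lambda>\<omega>. restrict (N \<omega>) B) -` S \<inter> space Q |S. S \<in> sets (Pi\<^sub>M B (\<lambda>_. D))})"
    by (simp add: Q.indep_var_eq)
  then show ?thesis
    unfolding sets_noise_sigma[symmetric]
    by (rule Q.indep_set_mono) (auto intro: sigma_sets.Basic)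
qed

lemma X_measurable_sigma:
  assumes "{..t} \<subseteq> A" shows "X t \<in> measurable (noise_sigma A) (count_space UNIV)"
proof -
  have "X t \<omega> = count t (restrict (N \<omega>) A)" for \<omega>
    by (rule count_cong) (use assms in auto)
  then show ?thesis
    using measurable_compose[OF noise_sigma_measurable count_measurable[OF sets_noise' assms]] by simp
qed

lemma M_measurable_sigma:
  assumes "{..<t} \<subseteq> A" shows "M t \<in> borel_measurable (noise_sigma A)"
proof -
  have "M t \<omega> = mean t (restrict (N \<omega>) A)" for \<omega>
    by (rule mean_cong) (use assms in auto)
  then show ?thesis
    using measurable_compose[OF noise_sigma_measurable mean_measurable[OF sets_noise' assms]] by simp
qed

lemma X_measurable: "X t \<in> measurable Q (count_space UNIV)"
  by (rule measurable_compose[OF N count_measurable[OF sets_noise']]) simp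

lemma M_measurable: "M t \<in> borel_measurable Q"
  by (rule measurable_compose[OF N mean_measurable[OF sets_noise']]) simp

section \<open>Finite-memory approximation and decay of \<open>tau_inf\<close>\<close>

abbreviation "Y n t \<omega> \<equiv> observe (mean_iter n t (N \<omega>)) t (N \<omega>)"

lemma Y_measurable: "Y n t \<in> measurable Q (count_space UNIV)"
  by (rule measurable_compose[OF N observe_mean_iter_measurable[OF sets_noise']]) simp

lemma Y_measurable_sigma:
  assumes "{t - int (n * lag)..t} \<subseteq> A" shows "Y n t \<in> measurable (noise_sigma A) (count_space UNIV)"
proof -
  have tA: "t \<in> A" by (rule subsetD[OF assms]) (simp del: of_nat_mult)
  have "mean_iter n t (N \<omega>) = mean_iter n t (restrict (N \<omega>) A)" for \<omega>
    by (rule mean_iter_cong) (simp add: subsetD[OF assms])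
  moreover have "observe \<alpha> t (N \<omega>) = observe \<alpha> t (restrict (N \<omega>) A)" for \<alpha> \<omega>
    by (rule observe_cong) (simp add: tA)
  ultimately have "Y n t \<omega> = observe (mean_iter n t (restrict (N \<omega>) A)) t (restrict (N \<omega>) A)" for \<omega>
    by simp
  then show ?thesis
    using measurable_compose[OF noise_sigma_measurable observe_mean_iter_measurable[OF sets_noise' assms]] by simp
qed

lemma nn_integral_noise:
  assumes "f \<in> borel_measurable C"
  shows "(\<integral>\<^sup>+\<omega>. f (N \<omega>) \<partial>Q) = (\<integral>\<^sup>+\<nu>. f \<nu> \<partial>C)"
  using nn_integral_distr[OF N, of f] assms by (simp add: law)

lemma nn_integral_X_diff:
  "(\<integral>\<^sup>+\<omega>. ennreal \<bar>real (X t \<omega>) - real (Y n t \<omega>)\<bar> \<partial>Q) = ennreal (a 0 * rate ^ n / (1 - rate))"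
proof -
  have m: "(\<lambda>\<nu>. real (count t \<nu>)) \<in> borel_measurable C"
    by (rule measurable_compose[OF count_measurable[OF sets_noise']]) auto
  have m': "(\<lambda>\<nu>. real (observe (mean_iter n t \<nu>) t \<nu>)) \<in> borel_measurable C"
    by (rule measurable_compose[OF observe_mean_iter_measurable[OF sets_noise']]) auto
  note [measurable] = m m'
  show ?thesis
    by (subst nn_integral_noise) (simp_all add: nn_integral_count_diff[OF E])
qed

lemma integrable_X: "integrable Q (\<lambda>\<omega>. real (X t \<omega>))"
proof (rule integrableI_bounded)
  show "(\<lambda>\<omega>. real (X t \<omega>)) \<in> borel_measurable Q"
    by (rule measurable_compose[OF X_measurable]) simp
  have "(\<lambda>\<nu>. of_nat (count t \<nu>) :: ennreal) \<in> borel_measurable C"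
    by (rule measurable_compose[OF count_measurable[OF sets_noise']]) auto
  then have "(\<integral>\<^sup>+\<omega>. ennreal (norm (real (X t \<omega>))) \<partial>Q) = (\<integral>\<^sup>+\<nu>. of_nat (count t \<nu>) \<partial>C)"
    by (subst nn_integral_noise[symmetric]) (simp_all add: ennreal_of_nat_eq_real_of_nat)
  then show "(\<integral>\<^sup>+\<omega>. ennreal (norm (real (X t \<omega>))) \<partial>Q) < \<infinity>"
    by (simp add: nn_integral_count[OF E] nn_integral_mean[OF E])
qed

lemma integrable_Y: "integrable Q (\<lambda>\<omega>. real (Y n t \<omega>))"
proof (rule integrableI_bounded)
  show "(\<lambda>\<omega>. real (Y n t \<omega>)) \<in> borel_measurable Q"
    by (rule measurable_compose[OF Y_measurable]) simp
  have "(\<lambda>\<nu>. of_nat (observe (mean_iter n t \<nu>) t \<nu>) :: ennreal) \<in> borel_measurable C"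
    by (rule measurable_compose[OF observe_mean_iter_measurable[OF sets_noise']]) auto
  then have "(\<integral>\<^sup>+\<omega>. ennreal (norm (real (Y n t \<omega>))) \<partial>Q) = (\<integral>\<^sup>+\<nu>. of_nat (observe (mean_iter n t \<nu>) t \<nu>) \<partial>C)"
    by (subst nn_integral_noise[symmetric]) (simp_all add: ennreal_of_nat_eq_real_of_nat)
  then show "(\<integral>\<^sup>+\<omega>. ennreal (norm (real (Y n t \<omega>))) \<partial>Q) < \<infinity>"
    by (simp add: nn_integral_observe_mean_iter[OF E] nn_integral_mean_iter[OF E])
qed

text \<open>The past of the process is a function of the noise at times up to 0. The hypothesis on
  \<open>j\<close> places the windows of all \<open>Y n (j k)\<close> at positive times, so the
  approximating vector is independent of that past and \<open>tau_le\<close> charges each coordinate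
  twice its L1 distance.\<close>

lemma tau_X_le:
  assumes j: "\<And>k. k < l \<Longrightarrow> int (n * lag) < j k"
  shows "tau Q (generated_sigma Q borel {..0} (\<lambda>t \<omega>. real (X t \<omega>))) l (\<lambda>\<omega>. \<lambda>k\<in>{..<l}. real (X (j k) \<omega>))
    \<le> of_nat l * ennreal (2 * a 0 * rate ^ n / (1 - rate))"
proof -
  let ?F = "generated_sigma Q borel {..0} (\<lambda>t \<omega>. real (X t \<omega>))"
  define V where "V \<omega> = map (\<lambda>k. X (j k) \<omega>) [0..<l]" for \<omega>
  define V' where "V' \<omega> = map (\<lambda>k. Y n (j k) \<omega>) [0..<l]" for \<omega>
  define \<phi> :: "nat list \<Rightarrow> nat \<Rightarrow> real" where "\<phi> d = (\<lambda>k\<in>{..<l}. real (d ! k))" for d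
  have FS: "sets ?F \<subseteq> sets (noise_sigma {..0})"
    by (rule sets_generated_sigma_subset)
       (auto intro!: measurable_compose[OF X_measurable_sigma])
  have V: "V \<in> measurable Q (count_space UNIV)"
    unfolding V_def by (intro measurable_map_upt X_measurable)
  have V': "V' \<in> measurable Q (count_space UNIV)"
    unfolding V'_def by (intro measurable_map_upt Y_measurable)
  \<comment> \<open>The strict inequality in \<open>j\<close> makes the earliest time used,
    \<open>j k - int (n * lag)\<close>, at least 1.\<close>
  have V'S: "V' \<in> measurable (noise_sigma {1..}) (count_space UNIV)"
    unfolding V'_def
    by (intro measurable_map_upt Y_measurable_sigma) (use j in force)
  have \<phi>V: "\<phi> (V \<omega>) = (\<lambda>k\<in>{..<l}. real (X (j k) \<omega>))" for \<omega>
    by (auto simp: \<phi>_def V_def)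
  have "tau Q ?F l (\<lambda>\<omega>. \<phi> (V \<omega>)) \<le> 2 * (\<integral>\<^sup>+\<omega>. (\<Sum>k<l. ennreal \<bar>\<phi> (V \<omega>) k - \<phi> (V' \<omega>) k\<bar>) \<partial>Q)"
  proof (rule Q.tau_le[OF _ V V'])
    show "subalgebra Q ?F"
      using FS sets_noise_sigma_subset by (auto simp: subalgebra_def)
    show "\<phi> d \<in> space (vec_space l)" for d by (simp add: \<phi>_def space_PiM)
    fix A d assume A: "A \<in> sets ?F"
    have "V' -` {d} \<inter> space Q \<in> sets (noise_sigma {1..})"
      using measurable_sets[OF V'S, of "{d}"] by simp
    then show "Q.prob (A \<inter> (V' -` {d} \<inter> space Q)) = Q.prob A * Q.prob (V' -` {d} \<inter> space Q)"
      using A FS by (intro Q.indep_setD[OF indep_noise_sigma[of "{..0}" "{1..}"]]) auto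
  next
    show "integrable Q (\<lambda>\<omega>. \<phi> (V \<omega>) k)" if "k < l" for k
      using that integrable_X by (simp add: \<phi>_def V_def)
    show "integrable Q (\<lambda>\<omega>. \<phi> (V' \<omega>) k)" if "k < l" for k
      using that integrable_Y by (simp add: \<phi>_def V'_def)
  qed
  also have "(\<integral>\<^sup>+\<omega>. (\<Sum>k<l. ennreal \<bar>\<phi> (V \<omega>) k - \<phi> (V' \<omega>) k\<bar>) \<partial>Q)
      = (\<integral>\<^sup>+\<omega>. (\<Sum>k<l. ennreal \<bar>real (X (j k) \<omega>) - real (Y n (j k) \<omega>)\<bar>) \<partial>Q)"
    by (intro nn_integral_cong sum.cong) (auto simp: \<phi>_def V_def V'_def)
  also have "\<dots> = (\<Sum>k<l. (\<integral>\<^sup>+\<omega>. ennreal \<bar>real (X (j k) \<omega>) - real (Y n (j k) \<omega>)\<bar> \<partial>Q))"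
    using integrable_X integrable_Y by (intro nn_integral_sum) auto
  also have "\<dots> = of_nat l * ennreal (a 0 * rate ^ n / (1 - rate))"
    by (simp add: nn_integral_X_diff)
  also have "2 * (of_nat l * ennreal (a 0 * rate ^ n / (1 - rate))) = of_nat l * ennreal (2 * a 0 * rate ^ n / (1 - rate))"
  proof -
    have "ennreal (2 * (a 0 * rate ^ n / (1 - rate))) = 2 * ennreal (a 0 * rate ^ n / (1 - rate))"
      using a0 rate by (subst ennreal_mult) auto
    then show ?thesis by (simp add: ac_simps)
  qed
  finally show ?thesis unfolding \<phi>V .
qed

text \<open>The bound of \<open>tau_X_le\<close> is linear in \<open>l\<close> and the same for all
  admissible times, so the normalisation by \<open>l\<close> cancels it to a constant.\<close>

lemma tau_inf_X_le:
  assumes "n * lag < r"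
  shows "tau_inf Q (\<lambda>t \<omega>. real (X t \<omega>)) r \<le> ennreal (2 * a 0 * rate ^ n / (1 - rate))"
  unfolding tau_inf_def
proof (rule SUP_least)
  let ?c = "ennreal (2 * a 0 * rate ^ n / (1 - rate))"
  fix l :: nat assume l: "l \<in> {1..}"
  have "(SUP j \<in> {j :: nat \<Rightarrow> int. strict_mono_on {..<l} j \<and> (\<forall>k<l. int r \<le> j k)}.
      tau Q (generated_sigma Q borel {..0} (\<lambda>t \<omega>. real (X t \<omega>))) l (\<lambda>\<omega>. \<lambda>k\<in>{..<l}. real (X (j k) \<omega>)))
      \<le> of_nat l * ?c"
  proof (rule SUP_least)
    fix j :: "nat \<Rightarrow> int"
    assume j: "j \<in> {j. strict_mono_on {..<l} j \<and> (\<forall>k<l. int r \<le> j k)}"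
    show "tau Q (generated_sigma Q borel {..0} (\<lambda>t \<omega>. real (X t \<omega>))) l (\<lambda>\<omega>. \<lambda>k\<in>{..<l}. real (X (j k) \<omega>))
        \<le> of_nat l * ?c"
    proof (rule tau_X_le)
      fix k assume "k < l"
      then have "int r \<le> j k" using j by simp
      then show "int (n * lag) < j k" using assms by linarith
    qed
  qed
  then have "(SUP j \<in> {j :: nat \<Rightarrow> int. strict_mono_on {..<l} j \<and> (\<forall>k<l. int r \<le> j k)}.
      tau Q (generated_sigma Q borel {..0} (\<lambda>t \<omega>. real (X t \<omega>))) l (\<lambda>\<omega>. \<lambda>k\<in>{..<l}. real (X (j k) \<omega>))) / of_nat l
      \<le> (of_nat l * ?c) / of_nat l"
    by (rule divide_right_mono_ennreal)
  also have "(of_nat l * ?c) / of_nat l = ?c"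
    using l by (subst mult.commute, intro ennreal_mult_divide_eq) (auto simp: less_top)
  finally show "(SUP j \<in> {j :: nat \<Rightarrow> int. strict_mono_on {..<l} j \<and> (\<forall>k<l. int r \<le> j k)}.
      tau Q (generated_sigma Q borel {..0} (\<lambda>t \<omega>. real (X t \<omega>))) l (\<lambda>\<omega>. \<lambda>k\<in>{..<l}. real (X (j k) \<omega>))) / of_nat l
      \<le> ?c" .
qed

lemma tau_inf_X_tendsto: "tau_inf Q (\<lambda>t \<omega>. real (X t \<omega>)) \<longlonglongrightarrow> 0"
proof (rule tendsto_sandwich[OF _ _ tendsto_const])
  \<comment> \<open>The largest \<open>n\<close> with \<open>n * lag < r\<close> when
    \<open>r\<close> is positive; subtracting 1 yields the strict inequality. That
    \<open>lag\<close> is positive comes from \<open>p\<close>.\<close>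
  define m where "m r = (r - 1) div lag" for r
  have lag: "lag > 0" using p by (simp add: lag_def)
  have "filterlim m at_top sequentially"
    unfolding filterlim_at_top
  proof
    fix z
    show "\<forall>\<^sub>F r in sequentially. z \<le> m r"
    proof (rule eventually_sequentiallyI)
      fix r assume "z * lag + 1 \<le> r"
      then have "(z * lag) div lag \<le> (r - 1) div lag" by (intro div_le_mono) simp
      then show "z \<le> m r" using lag by (simp add: m_def)
    qed
  qed
  moreover have "(\<lambda>n. 2 * a 0 * rate ^ n / (1 - rate)) \<longlonglongrightarrow> 2 * a 0 * 0 / (1 - rate)"
    using rate by (intro tendsto_intros LIMSEQ_realpow_zero) auto
  ultimately have "(\<lambda>r. 2 * a 0 * rate ^ m r / (1 - rate)) \<longlonglongrightarrow> 2 * a 0 * 0 / (1 - rate)"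
    by (rule filterlim_compose[rotated])
  then have "(\<lambda>r. ennreal (2 * a 0 * rate ^ m r / (1 - rate))) \<longlonglongrightarrow> ennreal (2 * a 0 * 0 / (1 - rate))"
    by (rule tendsto_ennrealI)
  then show "(\<lambda>r. ennreal (2 * a 0 * rate ^ m r / (1 - rate))) \<longlonglongrightarrow> 0" by simp
  show "\<forall>\<^sub>F r in sequentially. tau_inf Q (\<lambda>t \<omega>. real (X t \<omega>)) r \<le> ennreal (2 * a 0 * rate ^ m r / (1 - rate))"
  proof (rule eventually_sequentiallyI)
    fix r :: nat assume "1 \<le> r"
    moreover have "m r * lag \<le> r - 1" unfolding m_def by (rule div_times_less_eq_dividend)
    ultimately show "tau_inf Q (\<lambda>t \<omega>. real (X t \<omega>)) r \<le> ennreal (2 * a 0 * rate ^ m r / (1 - rate))"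
      by (intro tau_inf_X_le) simp
  qed
qed simp

lemma X_stationary_ergodic:
  "stationary Q (count_space UNIV) X" "ergodic Q (count_space UNIV) X"
  using factor_stationary_ergodic[OF D_prob N law count_measurable[OF sets_noise' subset_UNIV] count_shift]
  by simp_all

lemma X_weakly_dependent: "tau_weakly_dependent Q (\<lambda>t \<omega>. real (X t \<omega>))"
  unfolding tau_weakly_dependent_def
proof (intro conjI allI integrable_X tau_inf_X_tendsto)
  have "(\<lambda>\<nu>. real (count t \<nu>)) \<in> borel_measurable C" for t
    by (rule measurable_compose[OF count_measurable[OF sets_noise']]) auto
  then show "stationary Q borel (\<lambda>t \<omega>. real (X t \<omega>))"
    by (rule factor_stationary_ergodic(1)[OF D_prob N law]) (simp add: count_shift)
qed

text \<open>The past is determined by the noise before \<open>t\<close>, while innovation and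
  randomization are the two components of the noise at \<open>t\<close>, independent because
  \<open>D\<close> is a product. All independence requirements therefore come from one
  factorisation, \<open>triple\<close>.\<close>

lemma X_M_solution:
  "cmem_solution Q p q a b (\<lambda>t \<omega>. fst (N \<omega> t)) threshold_space (\<lambda>t \<omega>. snd (N \<omega> t)) count_below X M"
  unfolding cmem_solution_def
proof (intro conjI allI)
  have NK: "(\<lambda>\<omega>. N \<omega> t) \<in> measurable Q (count_space UNIV \<Otimes>\<^sub>M threshold_space)" for t
    using noise_measurable[of t] by (simp add: measurable_cong_sets[OF refl sets_noise'])
  have dK: "distr Q (count_space UNIV \<Otimes>\<^sub>M threshold_space) (\<lambda>\<omega>. N \<omega> t) = D" for t
    using distr_noise[of t] by (simp add: distr_cong[OF refl sets_noise' refl])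
  show "iid Q (count_space UNIV \<Otimes>\<^sub>M threshold_space) (\<lambda>t \<omega>. (fst (N \<omega> t), snd (N \<omega> t)))"
    unfolding iid_def
  proof (intro conjI allI)
    show "Q.indep_vars (\<lambda>_. count_space UNIV \<Otimes>\<^sub>M threshold_space) (\<lambda>t \<omega>. (fst (N \<omega> t), snd (N \<omega> t))) UNIV"
      using indep_noise NK by (simp add: Q.indep_vars_def sets_noise')
  qed (simp add: dK)
  fix t
  let ?Z = "\<lambda>\<omega>. snd (N \<omega> t)" and ?e = "\<lambda>\<omega>. fst (N \<omega> t)"
  have Z: "?Z \<in> measurable Q threshold_space" and e: "?e \<in> measurable Q (count_space UNIV)"
    using measurable_compose[OF NK measurable_snd] measurable_compose[OF NK measurable_fst] by auto
  interpret T: prob_space threshold_space by (rule prob_space_threshold_space)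
  interpret E: prob_space E by (rule E)
  have joint: "Q.prob ((\<lambda>\<omega>. N \<omega> t) -` (A \<times> B) \<inter> space Q) = measure E A * measure threshold_space B"
    if "B \<in> sets threshold_space" for A B
  proof -
    have AB: "A \<times> B \<in> sets D" using that E(2) by auto
    have "Q.prob ((\<lambda>\<omega>. N \<omega> t) -` (A \<times> B) \<inter> space Q) = measure D (A \<times> B)"
      using measure_distr[OF noise_measurable AB, of t] by (simp add: distr_noise)
    also have "\<dots> = measure E A * measure threshold_space B"
      using that E(2) by (simp add: measure_def T.emeasure_pair_measure_Times enn2real_mult)
    finally show ?thesis .
  qed
  have dZ: "distr Q threshold_space ?Z = threshold_space"
  proof (rule measure_eqI)
    fix B assume "B \<in> sets (distr Q threshold_space ?Z)"
    then have B: "B \<in> sets threshold_space" by simp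
    have "(\<lambda>\<omega>. N \<omega> t) -` (UNIV \<times> B) \<inter> space Q = ?Z -` B \<inter> space Q" by (auto simp: mem_Times_iff)
    then have "Q.prob (?Z -` B \<inter> space Q) = measure threshold_space B"
      using joint[OF B, of UNIV] E.prob_space space_E[OF E] by simp
    then show "emeasure (distr Q threshold_space ?Z) B = emeasure threshold_space B"
      using B by (simp add: emeasure_distr[OF Z] Q.emeasure_eq_measure T.emeasure_eq_measure)
  qed simp
  show "binomial_sampler Q threshold_space ?Z count_below"
    unfolding binomial_sampler_def
  proof (intro conjI allI ballI)
    fix n :: nat and \<pi> :: real assume \<pi>: "\<pi> \<in> {0..1}"
    have "distr Q (count_space UNIV) (\<lambda>\<omega>. count_below n \<pi> (?Z \<omega>))
        = distr (distr Q threshold_space ?Z) (count_space UNIV) (count_below n \<pi>)"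
      by (subst distr_distr[OF _ Z]) (auto simp: comp_def)
    then show "distr Q (count_space UNIV) (\<lambda>\<omega>. count_below n \<pi> (?Z \<omega>)) = measure_pmf (binomial_pmf n \<pi>)"
      unfolding dZ using distr_count_below \<pi> by simp
  qed (use Z count_below_measurable in auto)
  show "X t \<in> measurable Q (count_space UNIV)" by (rule X_measurable)
  show "M t \<in> borel_measurable Q" by (rule M_measurable)
  let ?past = "sets (cmem_past Q X M (t - 1))"
  let ?E = "sets (vimage_algebra (space Q) ?e (count_space UNIV))"
  let ?Zs = "sets (vimage_algebra (space Q) ?Z threshold_space)"
  have past: "?past \<subseteq> sets (noise_sigma {..t - 1})"
    unfolding cmem_past_def
    by (rule sets_generated_sigma_subset)
       (auto intro!: measurable_Pair X_measurable_sigma M_measurable_sigma)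
  have Es: "?E = {?e -` A \<inter> space Q |A. True}"
    by (subst sets_vimage_algebra2) auto
  have Zs: "?Zs = {?Z -` B \<inter> space Q |B. B \<in> sets threshold_space}"
    by (rule sets_vimage_algebra2) auto
  have EZ: "(\<lambda>\<omega>. N \<omega> t) -` (A \<times> B) \<inter> space Q \<in> sets (noise_sigma {t})" if "B \<in> sets threshold_space" for A B
  proof -
    have "A \<times> B \<in> sets D" using that E(2) by auto
    moreover have "(\<lambda>u. u t) \<in> measurable (Pi\<^sub>M {t} (\<lambda>_. D)) D"
      by (rule measurable_component_singleton) simp
    ultimately
    have s: "(\<lambda>u. u t) -` (A \<times> B) \<inter> space (Pi\<^sub>M {t} (\<lambda>_. D)) \<in> sets (Pi\<^sub>M {t} (\<lambda>_. D))"
      by (rule measurable_sets[rotated])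
    have "(\<lambda>\<omega>. N \<omega> t) -` (A \<times> B) \<inter> space Q
        = (\<lambda>\<omega>. restrict (N \<omega>) {t}) -` ((\<lambda>u. u t) -` (A \<times> B) \<inter> space (Pi\<^sub>M {t} (\<lambda>_. D))) \<inter> space (noise_sigma {t})"
      using measurable_space[OF restrict_noise_measurable, of _ "{t}"] by auto
    also have "\<dots> \<in> sets (noise_sigma {t})" by (rule measurable_sets[OF noise_sigma_measurable s])
    finally show ?thesis .
  qed
  \<comment> \<open>Taking the whole space for \<open>B\<close>, and then also for \<open>H\<close>,
    specialises this to \<open>double\<close> and \<open>single_e\<close>.\<close>
  have triple: "Q.prob (H \<inter> (?e -` A \<inter> space Q) \<inter> (?Z -` B \<inter> space Q))
      = Q.prob H * measure E A * measure threshold_space B"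
    if H: "H \<in> sets (noise_sigma {..t - 1})" and B: "B \<in> sets threshold_space" for H A B
  proof -
    have "H \<inter> (?e -` A \<inter> space Q) \<inter> (?Z -` B \<inter> space Q) = H \<inter> ((\<lambda>\<omega>. N \<omega> t) -` (A \<times> B) \<inter> space Q)"
      by (auto simp: mem_Times_iff)
    then show ?thesis
      using Q.indep_setD[OF indep_noise_sigma[of "{..t - 1}" "{t}"] H EZ[OF B]] joint[OF B] by simp
  qed
  have spZ: "?Z -` space threshold_space \<inter> space Q = space Q" by auto
  have double: "Q.prob (H \<inter> (?e -` A \<inter> space Q)) = Q.prob H * measure E A"
    if H: "H \<in> sets (noise_sigma {..t - 1})" for H A
    using triple[OF H sets.top, of A] T.prob_space unfolding spZ
    by (simp add: Int_assoc)
  have single_e: "Q.prob (?e -` A \<inter> space Q) = measure E A" for A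
    using double[of "space Q" A] sets.top[of "noise_sigma {..t - 1}"] Q.prob_space
    by (simp add: Int_absorb1)
  have single_Z: "Q.prob (?Z -` B \<inter> space Q) = measure threshold_space B" if B: "B \<in> sets threshold_space" for B
    using measure_distr[OF Z B] by (simp add: dZ)
  have ev: "sets (noise_sigma {..t - 1}) \<subseteq> Q.events" "?E \<subseteq> Q.events" "?Zs \<subseteq> Q.events"
    using sets_noise_sigma_subset measurable_sets[OF e] measurable_sets[OF Z] unfolding Es Zs by auto
  have "Q.indep_set (sets (noise_sigma {..t - 1})) ?E"
    using ev by (intro Q.indep_setI) (auto simp: Es double single_e)
  then show "Q.indep_set ?past ?E"
    by (rule Q.indep_set_mono[OF _ past]) simp
  \<comment> \<open>An intersection-stable generator of the joint sigma-field of past and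
    innovation. It contains either family because the other contains the whole space, and on it
    independence of the randomization is just \<open>triple\<close>.\<close>
  define G where "G = {H \<inter> e' |H e'. H \<in> sets (noise_sigma {..t - 1}) \<and> e' \<in> ?E}"
  have G_ev: "G \<subseteq> Q.events" unfolding G_def using ev by auto
  have "Q.indep_set G ?Zs"
  proof (rule Q.indep_setI[OF G_ev ev(3)])
    fix g z assume "g \<in> G" "z \<in> ?Zs"
    then obtain H A B where "H \<in> sets (noise_sigma {..t - 1})" "g = H \<inter> (?e -` A \<inter> space Q)"
      "B \<in> sets threshold_space" "z = ?Z -` B \<inter> space Q"
      unfolding G_def Es Zs by blast
    then show "Q.prob (g \<inter> z) = Q.prob g * Q.prob z"
      using triple double single_Z by simp
  qed
  moreover have "Int_stable G"
  proof (rule Int_stableI)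
    fix x y assume "x \<in> G" "y \<in> G"
    then obtain H e1 K e2 where "x = H \<inter> e1" "y = K \<inter> e2" "H \<in> sets (noise_sigma {..t - 1})"
      "K \<in> sets (noise_sigma {..t - 1})" "e1 \<in> ?E" "e2 \<in> ?E"
      unfolding G_def by blast
    then have "x \<inter> y = (H \<inter> K) \<inter> (e1 \<inter> e2)" "H \<inter> K \<in> sets (noise_sigma {..t - 1})" "e1 \<inter> e2 \<in> ?E"
      by auto
    then show "x \<inter> y \<in> G" unfolding G_def by blast
  qed
  moreover have "Int_stable ?Zs" by (rule sets.Int_stable)
  ultimately have "Q.indep_set (sigma_sets (space Q) G) (sigma_sets (space Q) ?Zs)"
    by (rule Q.indep_set_sigma_sets)
  then show "Q.indep_set (sigma_sets (space Q) (?past \<union> ?E)) ?Zs"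
  proof (rule Q.indep_set_mono)
    have "?past \<subseteq> G"
    proof
      fix H assume H: "H \<in> ?past"
      then have "H = H \<inter> space Q" using past ev(1) sets.sets_into_space by blast
      moreover have "space Q \<in> ?E" using sets.top[of "vimage_algebra (space Q) ?e (count_space UNIV)"] by simp
      ultimately show "H \<in> G" using H past unfolding G_def by blast
    qed
    moreover have "?E \<subseteq> G"
    proof
      fix F assume F: "F \<in> ?E"
      then have "F = space Q \<inter> F" using ev(2) sets.sets_into_space by blast
      moreover have "space Q \<in> sets (noise_sigma {..t - 1})" using sets.top[of "noise_sigma {..t - 1}"] by simp
      ultimately show "F \<in> G" using F unfolding G_def by blast
    qed
    ultimately show "sigma_sets (space Q) (?past \<union> ?E) \<subseteq> sigma_sets (space Q) G"
      by (intro sigma_sets_mono') blast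
    show "?Zs \<subseteq> sigma_sets (space Q) ?Zs" by (auto intro: sigma_sets.Basic)
  qed
  have AE: "AE \<omega> in Q. \<forall>t. (SUP n. ennreal (mean_iter n t (N \<omega>))) \<noteq> \<infinity>"
    by (rule AE_distrD[OF N]) (simp only: law AE_mean_iter_bounded[OF E])
  then show "AE \<omega> in Q. 0 < M t \<omega>"
  proof eventually_elim
    case (elim \<omega>)
    show ?case by (rule mean_pos) (use elim in blast)
  qed
  show "AE \<omega> in Q. X t \<omega> = binomial_mult count_below (M t \<omega>) (?e \<omega>) (?Z \<omega>)"
    by (simp add: count_def observe_def)
  from AE show "AE \<omega> in Q. M t \<omega> = a 0 + (\<Sum>i=1..p. a i * real (X (t - int i) \<omega>)) + (\<Sum>j=1..q. b j * M (t - int j) \<omega>)"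
  proof eventually_elim
    case (elim \<omega>)
    show ?case by (rule mean_fixpoint) (use elim in blast)
  qed
qed

end

theorem theorem3p2p1:
  fixes P :: "'w measure" and \<epsilon> :: "int \<Rightarrow> 'w \<Rightarrow> nat"
    and p q :: nat and a b :: "nat \<Rightarrow> real" and \<sigma> :: real
  assumes "prob_space P"
    and "p \<ge> 1"
    and "a 0 > 0" and "\<forall>i\<in>{1..p}. a i \<ge> 0" and "\<forall>j\<in>{1..q}. b j \<ge> 0"
    and "iid P (count_space UNIV) \<epsilon>"
    and "\<forall>t. integrable P (\<lambda>\<omega>. real (\<epsilon> t \<omega>))"
    and "\<forall>t. integrable P (\<lambda>\<omega>. (real (\<epsilon> t \<omega>))\<^sup>2)"
    and "\<forall>t. prob_space.expectation P (\<lambda>\<omega>. real (\<epsilon> t \<omega>)) = 1"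
    and "\<forall>t. prob_space.variance P (\<lambda>\<omega>. real (\<epsilon> t \<omega>)) = \<sigma>\<^sup>2"
    and "(\<Sum>i=1..p. a i) + (\<Sum>j=1..q. b j) < 1"
  shows "\<exists>(Q :: ('w \<times> (int \<Rightarrow> nat \<Rightarrow> real)) measure) (S :: (nat \<Rightarrow> real) measure) Z B X M.
    prob_space Q \<and> fst \<in> measurable Q P \<and> distr Q P fst = P \<and>
    cmem_solution Q p q a b (\<lambda>t \<omega>. \<epsilon> t (fst \<omega>)) S Z B X M \<and>
    tau_weakly_dependent Q (\<lambda>t \<omega>. real (X t \<omega>)) \<and>
    stationary Q (count_space UNIV) X \<and>
    ergodic Q (count_space UNIV) X"
proof -
  interpret P: prob_space P by fact
  define E where "E = distr P (count_space UNIV) (\<epsilon> 0)"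
  have iv: "P.indep_vars (\<lambda>_. count_space UNIV) \<epsilon> UNIV"
    and ids: "\<And>s t. distr P (count_space UNIV) (\<epsilon> s) = distr P (count_space UNIV) (\<epsilon> t)"
    using assms(6) by (auto simp: iid_def)
  have em: "\<epsilon> t \<in> measurable P (count_space UNIV)" for t
    using iv by (auto simp: P.indep_vars_def)
  have sE: "sets E = UNIV" by (simp add: E_def)
  have pE: "prob_space E" unfolding E_def by (rule P.prob_space_distr[OF em])
  have mE: "(\<integral>\<^sup>+n. of_nat n \<partial>E) = 1"
  proof -
    have "(\<integral>\<^sup>+n. of_nat n \<partial>E) = (\<integral>\<^sup>+\<omega>. ennreal (real (\<epsilon> 0 \<omega>)) \<partial>P)"
      unfolding E_def by (subst nn_integral_distr[OF em]) (simp_all add: ennreal_of_nat_eq_real_of_nat)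
    also have "\<dots> = 1" using assms(7,9) by (subst nn_integral_eq_integral) auto
    finally show ?thesis .
  qed
  \<comment> \<open>\<open>E\<close> carries the discrete sigma-field and is also the law of each
    innovation; \<open>distr_pair_PiM_iid\<close> uses it in both roles.\<close>
  have ivE: "P.indep_vars (\<lambda>_. E) \<epsilon> UNIV"
    using iv by (simp add: P.indep_vars_def E_def)
  have dE: "distr P E (\<epsilon> t) = E" for t
  proof -
    have "distr P E (\<epsilon> t) = distr P (count_space UNIV) (\<epsilon> t)"
      by (rule distr_cong) (simp_all add: sE)
    also have "\<dots> = E" unfolding E_def by (rule ids)
    finally show ?thesis .
  qed
  \<comment> \<open>The given space may be too small to carry further randomization, so the
    thresholds are adjoined as an independent factor; projecting to the first coordinate recovers
    \<open>P\<close> and the given sequence.\<close>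
  define U where "U = Pi\<^sub>M (UNIV :: int set) (\<lambda>_. threshold_space)"
  define Q where "Q = P \<Otimes>\<^sub>M U"
  define N where "N = (\<lambda>(\<omega>, u) t. (\<epsilon> t \<omega>, u t :: nat \<Rightarrow> real))"
  have U: "prob_space U" unfolding U_def by (intro prob_space_PiM prob_space_threshold_space)
  interpret U: prob_space U by (rule U)
  have Q: "prob_space Q" unfolding Q_def by (rule prob_space_pair[OF P.prob_space_axioms U])
  note pairs = distr_pair_PiM_iid[OF P.prob_space_axioms prob_space_threshold_space ivE dE, folded U_def Q_def N_def]
  interpret noise_driven p q a b Q E N
    unfolding noise_driven_def noise_driven_axioms_def count_mem_def
    using assms pE sE mE pairs Q by auto
  have fst_law: "distr Q P fst = P"
    unfolding Q_def by (rule U.distr_pair_fst)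
  have "cmem_solution Q p q a b (\<lambda>t \<omega>. \<epsilon> t (fst \<omega>)) threshold_space (\<lambda>t \<omega>. snd (N \<omega> t)) count_below X M"
    using X_M_solution by (simp add: N_def case_prod_beta)
  moreover have "fst \<in> measurable Q P" unfolding Q_def by simp
  ultimately show ?thesis
    using Q fst_law X_weakly_dependent X_stationary_ergodic by blast
qed

end
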